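(* Let $x_k$ be generated by the model-based iteration $$x_{k+1}=\operatorname*{argmin}_{y\in X}\Big\{f_{x_k}(y;S_k)+\varphi(y)+\frac{1}{2\alpha_k}\|y-x_k\|^2\Big\},\qquad S_k\stackrel{\text{i.i.d.}}{\sim}P,$$ started from $x_0\in X$, where the models $f_x(\cdot;s)$ satisfy conditions (C.i)--(C.iv) and the stepsizes $\alpha_k>0$ satisfy $\sum_k\alpha_k=\infty$ and $\sum_k\alpha_k^2<\infty$. Assume (L), (W), that with probability 1 the iterates are bounded, $\sup_k\|x_k\|<\infty$, and that the function equal to $F$ on $X$ and $+\infty$ off $X$ is coercive (tends to $+\infty$ as $\|x\|\to\infty$). Then with probability 1, $$\Big[\liminf_k F(x_k),\ \limsup_k F(x_k)\Big]\subseteq F(X^\star)=\{F(x):x\in X^\star\}.$$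
   Context: Setting. $P$ is a probability distribution on a sample space $\mathcal S$, and $S\sim P$. $X\subset\mathbb R^d$ is a nonempty closed convex set and $\varphi:\mathbb R^d\to\mathbb R$ is a closed convex function. For each $s\in\mathcal S$, $f(\cdot;s):\mathbb R^d\to\mathbb R$; $f(x)=\mathbb E_P[f(x;S)]$ is finite for every $x\in\mathbb R^d$, and $F(x)=f(x)+\varphi(x)$. All functions of $s$ involved are measurable. $\|\cdot\|$ is the Euclidean norm and $\mathbb B$ the unit ball. For a function $h:\mathbb R^d\to\mathbb R\cup\{+\infty\}$, $\partial h(x)=\{g: h(y)\ge h(x)+\langle g,y-x\rangle+o(\|y-x\|)\text{ as }y\to x\}$ is the Fréchet subdifferential (the usual subdifferential for convex $h$). (L) With $M_\epsilon(x;s)=\sup_{y\in X,\|y-x\|\le\epsilon}\ \sup_{g\in\partial f(y;s)}\|g\|$, there is $\epsilon_0>0$ such that $0<\epsilon\le\epsilon_0$ implies $\mathbb E[M_\epsilon(x;S)^2]<\infty$ for all $x\in X$. (W) There is $\epsilon_0>0$ such that $0<\epsilon\le\epsilon_0$ implies that for all $x\in X$ there is $\lambda(s,x)\ge0$ such that $y\mapsto f(y;s)+\frac{\lambda(s,x)}2\|y-x_0\|^2$ is convex on $x+\epsilon\mathbb B$ for any $x_0\in\mathbb R^d$, and $\mathbb E[\lambda(S,x)]<\infty$. Models. For each $x\in X$ and $s\in\mathcal S$ one has a model $f_x(\cdot;s):\mathbb R^d\to\mathbb R\cup\{+\infty\}$ of $f(\cdot;s)$ at $x$; the argmin in the iteration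 is assumed attained (it is then unique) and measurable in $s$. Conditions: (C.i) $y\mapsto f_x(y;s)$ is convex and subdifferentiable on its domain. (C.ii) $f_x(x;s)=f(x;s)$. (C.iii) $\partial_y f_x(y;s)|_{y=x}\subset\partial f(x;s)$. (C.iv) There is $\epsilon_0>0$ such that $0<\epsilon\le\epsilon_0$ implies that for all $x_0\in X$ there is $\delta_\epsilon(x_0;s)\ge0$ with $f(y;s)\ge f_x(y;s)-\frac12\delta_\epsilon(x_0;s)\|y-x\|^2$ for all $x\in X\cap(x_0+\epsilon\mathbb B)$, $y\in x_0+\epsilon\mathbb B$, where $\mathbb E[\delta_\epsilon(x_0;S)]<\infty$. Stationary set: $X^\star=\{x\in X:\exists\, g\in\partial f(x)+\partial\varphi(x)\text{ with }\langle g,y-x\rangle\ge0\text{ for all }y\in X\}$. *)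

theory Defs
  imports "HOL-Probability.Probability" "HOL-Library.Landau_Symbols"
begin

text \<open>
  Frechet subdifferential of an extended-real-valued function; it is empty at points where
  \<open>h\<close> is not finite. The function \<open>r\<close> is the \<open>o(norm (y - x))\<close> remainder.
\<close>

definition frechet_subdiff :: "('a::euclidean_space \<Rightarrow> ereal) \<Rightarrow> 'a \<Rightarrow> 'a set" where
  "frechet_subdiff h x =
     {g. \<bar>h x\<bar> \<noteq> \<infinity> \<and>
         (\<exists>r :: 'a \<Rightarrow> real. r \<in> o[at x](\<lambda>y. norm (y - x)) \<and>
            (\<forall>\<^sub>F y in at x. h y \<ge> h x + ereal (g \<bullet> (y - x) + r y)))}"

abbreviation frechet_subdiff_real :: "('a::euclidean_space \<Rightarrow> real) \<Rightarrow> 'a \<Rightarrow> 'a set" where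
  "frechet_subdiff_real h \<equiv> frechet_subdiff (\<lambda>y. ereal (h y))"

text \<open>
  Only used for functions that never take the value \<open>-\<infinity>\<close>. Since \<open>0 * \<infinity> = 0\<close> in \<^typ>\<open>ereal\<close>,
  the cases \<open>u = 0\<close> and \<open>v = 0\<close> are vacuous.
\<close>

definition ereal_convex :: "('a::real_vector \<Rightarrow> ereal) \<Rightarrow> bool" where
  "ereal_convex h \<longleftrightarrow>
     (\<forall>y z u v. u \<ge> 0 \<longrightarrow> v \<ge> 0 \<longrightarrow> u + v = 1 \<longrightarrow>
        h (u *\<^sub>R y + v *\<^sub>R z) \<le> ereal u * h y + ereal v * h z)"

text \<open>Throughout, \<open>f x s\<close> stands for \<open>f(x; s)\<close> and \<open>m x y s\<close> for the model \<open>f\<^sub>x(y; s)\<close>.\<close>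

definition mean_fun :: "'s measure \<Rightarrow> ('a \<Rightarrow> 's \<Rightarrow> real) \<Rightarrow> 'a \<Rightarrow> real" where
  "mean_fun P f x = (\<integral>s. f x s \<partial>P)"

definition objective ::
  "'s measure \<Rightarrow> ('a \<Rightarrow> 's \<Rightarrow> real) \<Rightarrow> ('a \<Rightarrow> real) \<Rightarrow> 'a \<Rightarrow> real" where
  "objective P f \<phi> x = mean_fun P f x + \<phi> x"

definition subgrad_bound ::
  "'a::euclidean_space set \<Rightarrow> ('a \<Rightarrow> 's \<Rightarrow> real) \<Rightarrow> real \<Rightarrow> 'a \<Rightarrow> 's \<Rightarrow> ennreal" where
  "subgrad_bound X f \<epsilon> x s =
     (SUP y \<in> {y \<in> X. norm (y - x) \<le> \<epsilon>}. SUP g \<in> frechet_subdiff_real (\<lambda>z. f z s) y. ennreal (norm g))"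

definition local_lipschitz_cond ::
  "'s measure \<Rightarrow> 'a::euclidean_space set \<Rightarrow> ('a \<Rightarrow> 's \<Rightarrow> real) \<Rightarrow> bool" where
  "local_lipschitz_cond P X f \<longleftrightarrow>
     (\<exists>\<epsilon>0>0. \<forall>\<epsilon>. 0 < \<epsilon> \<and> \<epsilon> \<le> \<epsilon>0 \<longrightarrow>
        (\<forall>x\<in>X. subgrad_bound X f \<epsilon> x \<in> borel_measurable P \<and>
               (\<integral>\<^sup>+s. (subgrad_bound X f \<epsilon> x s)\<^sup>2 \<partial>P) < \<infinity>))"

definition weak_convexity_cond ::
  "'s measure \<Rightarrow> 'a::euclidean_space set \<Rightarrow> ('a \<Rightarrow> 's \<Rightarrow> real) \<Rightarrow> bool" where
  "weak_convexity_cond P X f \<longleftrightarrow>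
     (\<exists>\<epsilon>0>0. \<forall>\<epsilon>. 0 < \<epsilon> \<and> \<epsilon> \<le> \<epsilon>0 \<longrightarrow>
        (\<forall>x\<in>X. \<exists>lam :: 's \<Rightarrow> real.
           integrable P lam \<and>
           (\<forall>s\<in>space P. lam s \<ge> 0 \<and>
              (\<forall>x0. convex_on (cball x \<epsilon>) (\<lambda>y. f y s + lam s / 2 * (norm (y - x0))\<^sup>2)))))"

definition model_convex ::
  "'s measure \<Rightarrow> 'a::euclidean_space set \<Rightarrow> ('a \<Rightarrow> 'a \<Rightarrow> 's \<Rightarrow> ereal) \<Rightarrow> bool" where
  "model_convex P X m \<longleftrightarrow>
     (\<forall>x\<in>X. \<forall>s\<in>space P.
        ereal_convex (\<lambda>y. m x y s) \<and>
        (\<forall>y. m x y s < \<infinity> \<longrightarrow> frechet_subdiff (\<lambda>z. m x z s) y \<noteq> {}))"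

definition model_value ::
  "'s measure \<Rightarrow> 'a set \<Rightarrow> ('a \<Rightarrow> 's \<Rightarrow> real) \<Rightarrow> ('a \<Rightarrow> 'a \<Rightarrow> 's \<Rightarrow> ereal) \<Rightarrow> bool" where
  "model_value P X f m \<longleftrightarrow> (\<forall>x\<in>X. \<forall>s\<in>space P. m x x s = ereal (f x s))"

definition model_subdiff ::
  "'s measure \<Rightarrow> 'a::euclidean_space set \<Rightarrow> ('a \<Rightarrow> 's \<Rightarrow> real) \<Rightarrow> ('a \<Rightarrow> 'a \<Rightarrow> 's \<Rightarrow> ereal) \<Rightarrow> bool" where
  "model_subdiff P X f m \<longleftrightarrow>
     (\<forall>x\<in>X. \<forall>s\<in>space P.
        frechet_subdiff (\<lambda>y. m x y s) x \<subseteq> frechet_subdiff_real (\<lambda>y. f y s) x)"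

definition model_accuracy ::
  "'s measure \<Rightarrow> 'a::euclidean_space set \<Rightarrow> ('a \<Rightarrow> 's \<Rightarrow> real) \<Rightarrow> ('a \<Rightarrow> 'a \<Rightarrow> 's \<Rightarrow> ereal) \<Rightarrow> bool" where
  "model_accuracy P X f m \<longleftrightarrow>
     (\<exists>\<epsilon>0>0. \<forall>\<epsilon>. 0 < \<epsilon> \<and> \<epsilon> \<le> \<epsilon>0 \<longrightarrow>
        (\<forall>x0\<in>X. \<exists>\<delta> :: 's \<Rightarrow> real.
           integrable P \<delta> \<and>
           (\<forall>s\<in>space P. \<delta> s \<ge> 0 \<and>
              (\<forall>x \<in> X \<inter> cball x0 \<epsilon>. \<forall>y \<in> cball x0 \<epsilon>.
                 ereal (f y s) \<ge> m x y s - ereal (1 / 2 * \<delta> s * (norm (y - x))\<^sup>2)))))"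

text \<open>
  For finite convex \<open>\<phi>\<close> the Frechet subdifferential is the usual convex one.
\<close>

definition stationary_set ::
  "'s measure \<Rightarrow> 'a::euclidean_space set \<Rightarrow> ('a \<Rightarrow> 's \<Rightarrow> real) \<Rightarrow> ('a \<Rightarrow> real) \<Rightarrow> 'a set" where
  "stationary_set P X f \<phi> =
     {x \<in> X. \<exists>g \<in> {u + v | u v. u \<in> frechet_subdiff_real (mean_fun P f) x \<and> v \<in> frechet_subdiff_real \<phi> x}.
        \<forall>y\<in>X. g \<bullet> (y - x) \<ge> 0}"

text \<open>
  The function minimised over \<open>y \<in> X\<close> in one iteration from \<open>x\<close> with stepsize \<open>a\<close> and sample \<open>s\<close>.
\<close>

definition model_step_objective ::
  "('a::euclidean_space \<Rightarrow> 'a \<Rightarrow> 's \<Rightarrow> ereal) \<Rightarrow> ('a \<Rightarrow> real) \<Rightarrow> real \<Rightarrow> 'a \<Rightarrow> 's \<Rightarrow> 'a \<Rightarrow> ereal" where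
  "model_step_objective m \<phi> a x s y =
     m x y s + ereal (\<phi> y) + ereal (1 / (2 * a) * (norm (y - x))\<^sup>2)"

text \<open>The sigma-algebra on \<open>\<Omega>\<close> generated by the first \<open>k\<close> samples \<open>S 0, \<dots>, S (k - 1)\<close>.\<close>

definition past_samples :: "'w measure \<Rightarrow> 's measure \<Rightarrow> (nat \<Rightarrow> 'w \<Rightarrow> 's) \<Rightarrow> nat \<Rightarrow> 'w measure" where
  "past_samples \<Omega> P S k =
     vimage_algebra (space \<Omega>) (\<lambda>\<omega>. \<lambda>i\<in>{..<k}. S i \<omega>) (\<Pi>\<^sub>M i\<in>{..<k}. P)"

text \<open>
  \<open>S\<close> is an i.i.d. sequence with law \<open>P\<close> on the probability space \<open>\<Omega>\<close>, and \<open>x\<close> is generated from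
  \<open>x0\<close> by the model-based iteration. The condition \<^const>\<open>is_arg_min\<close> says that the argmin is
  attained, at \<open>x (Suc k) \<omega>\<close>. Measurability of the argmin is the requirement that \<open>x k\<close> be a
  measurable function of the samples \<open>S 0, \<dots>, S (k - 1)\<close> that determine it.
\<close>

definition model_based_iteration ::
  "'w measure \<Rightarrow> 's measure \<Rightarrow> 'a::euclidean_space set \<Rightarrow> ('a \<Rightarrow> 'a \<Rightarrow> 's \<Rightarrow> ereal) \<Rightarrow> ('a \<Rightarrow> real) \<Rightarrow>
   (nat \<Rightarrow> real) \<Rightarrow> (nat \<Rightarrow> 'w \<Rightarrow> 's) \<Rightarrow> 'a \<Rightarrow> (nat \<Rightarrow> 'w \<Rightarrow> 'a) \<Rightarrow> bool" where
  "model_based_iteration \<Omega> P X m \<phi> \<alpha> S x0 x \<longleftrightarrow>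
     prob_space.indep_vars \<Omega> (\<lambda>_. P) S UNIV \<and>
     (\<forall>k. distr \<Omega> P (S k) = P) \<and>
     (\<forall>\<omega>\<in>space \<Omega>. x 0 \<omega> = x0) \<and>
     (\<forall>k. \<forall>\<omega>\<in>space \<Omega>.
        is_arg_min (model_step_objective m \<phi> (\<alpha> k) (x k \<omega>) (S k \<omega>)) (\<lambda>y. y \<in> X) (x (Suc k) \<omega>)) \<and>
     (\<forall>k. x k \<in> borel_measurable (past_samples \<Omega> P S k))"

end

theory Submission
  imports Defs
begin

text \<open>
  The Lyapunov function is the Moreau envelope of the objective over the constraint set,
  \<open>env l x = (INF y\<in>X. F y + norm (y - x) ^ 2 / (2 l))\<close>. It lies below \<open>F\<close> on \<open>X\<close>, and a point where
  the two agree minimises \<open>F y + norm (y - x) ^ 2 / (2 l)\<close> over \<open>X\<close>; weak convexity turns this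
  minimality into stationarity (\<open>stationary_if_proximal_fixpoint\<close>). It is therefore enough to show
  that the gap \<open>F - env l\<close> tends to \<open>0\<close> along the iterates and that the iterates move slowly: every
  number between the lower and the upper limit of the values is then the value of \<open>F\<close> at a
  cluster point, which is stationary (\<open>limit_values_are_stationary_values\<close>).

  While the iterate stays in a fixed ball and \<open>l\<close> is small, comparing the model step with a proximal
  point shows that the envelope decreases in mean by \<open>a / l\<close> times the gap, up to a multiple of
  \<open>a\<^sup>2\<close> (\<open>one_step_descent\<close>). Since the squared stepsizes are summable, the expectation of
  \<open>\<Sum>k. \<alpha> k * gap k\<close>, stopped at the exit from the ball, is finite. The displacement in step \<open>k\<close> is at most
  \<open>\<alpha> k\<close> times a square integrable function of the sample, which is independent of the past, so the
  sum of displacement times gap is finite as well. A path on which both sums converge while the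
  stepsizes diverge can have a gap of size \<open>e\<close> only finitely often: the gap must later fall
  below \<open>e / 2\<close>, and by uniform continuity this takes a path of a certain length, travelled at a
  gap of at least \<open>e / 2\<close> (\<open>tendsto_zero_along_path\<close>).
  Boundedness of the iterates then gives the claim, through balls of integer radius.

  A proximal point of the current iterate is not obviously a measurable function of it, and neither
  is the model jointly in its centre and the sample. For the expected decrease the current
  iterate is therefore frozen at one of finitely many nearby points, so that only functions of the new sample
  are integrated (\<open>expectation_le_by_freezing\<close>).
\<close>

section \<open>Convex separation and subgradients\<close>
text \<open>
  The strict epigraph of \<open>p\<close> is separated from the hypograph of \<open>p x + q x - q\<close>, and \<open>g\<close> is the slope
  of the separating hyperplane. The hyperplane cannot be vertical because \<open>x\<close> is interior to \<open>U\<close>.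
  Used twice, this yields the sum rule for subgradients and for the normal cone of a constraint set.
\<close>
lemma convex_sandwich:
  fixes p q :: "'a::euclidean_space \<Rightarrow> real"
  assumes U: "open U" and p: "convex_on U p" and q: "convex_on C q"
    and xU: "x \<in> U" and xC: "x \<in> C"
    and min: "\<And>y. y \<in> U \<Longrightarrow> y \<in> C \<Longrightarrow> p x + q x \<le> p y + q y"
  obtains g where "\<And>y. y \<in> U \<Longrightarrow> p x + g \<bullet> (y - x) \<le> p y"
    and "\<And>y. y \<in> C \<Longrightarrow> q x - g \<bullet> (y - x) \<le> q y"
proof -
  define S where "S = {(y, t). y \<in> U \<and> p y < t}"
  define T where "T = {(y, t). y \<in> C \<and> t \<le> p x + q x - q y}"
  have cvxS: "convex S"
    unfolding convex_def
  proof (intro ballI allI impI)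
    fix P Q and u v :: real
    assume PQ: "P \<in> S" "Q \<in> S" and uv: "0 \<le> u" "0 \<le> v" "u + v = 1"
    obtain a s b t where eq: "P = (a, s)" "Q = (b, t)" by (metis surj_pair)
    have in_U: "a \<in> U" "b \<in> U" and less: "p a < s" "p b < t"
      using PQ by (auto simp: eq S_def)
    have "p (u *\<^sub>R a + v *\<^sub>R b) \<le> u * p a + v * p b"
      using p in_U uv unfolding convex_on_def by blast
    also have "\<dots> < u * s + v * t"
    proof (cases "u = 0")
      case True
      then show ?thesis using less uv by simp
    next
      case False
      then have "u * p a < u * s" using less uv by simp
      moreover have "v * p b \<le> v * t" using less uv by (simp add: mult_left_mono)
      ultimately show ?thesis by linarith
    qed
    finally show "u *\<^sub>R P + v *\<^sub>R Q \<in> S"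
      using convexD[OF convex_on_imp_convex[OF p] in_U uv] by (simp add: eq S_def)
  qed
  have cvxT: "convex T"
    unfolding convex_def
  proof (intro ballI allI impI)
    fix P Q and u v :: real
    assume PQ: "P \<in> T" "Q \<in> T" and uv: "0 \<le> u" "0 \<le> v" "u + v = 1"
    obtain a s b t where eq: "P = (a, s)" "Q = (b, t)" by (metis surj_pair)
    have in_C: "a \<in> C" "b \<in> C" and le: "s \<le> p x + q x - q a" "t \<le> p x + q x - q b"
      using PQ by (auto simp: eq T_def)
    have "q (u *\<^sub>R a + v *\<^sub>R b) \<le> u * q a + v * q b"
      using q in_C uv unfolding convex_on_def by blast
    moreover have "u * s + v * t \<le> u * (p x + q x - q a) + v * (p x + q x - q b)"
      using le uv by (intro add_mono mult_left_mono)
    moreover have "u * (p x + q x - q a) + v * (p x + q x - q b)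
        = (u + v) * (p x + q x) - (u * q a + v * q b)"
      by (simp add: algebra_simps)
    ultimately have "u * s + v * t \<le> p x + q x - q (u *\<^sub>R a + v *\<^sub>R b)"
      using uv by simp
    then show "u *\<^sub>R P + v *\<^sub>R Q \<in> T"
      using convexD[OF convex_on_imp_convex[OF q] in_C uv] by (simp add: eq T_def)
  qed
  have "(x, p x + 1) \<in> S" "(x, p x) \<in> T"
    using xU xC by (auto simp: S_def T_def)
  moreover have "S \<inter> T = {}"
    using min by (fastforce simp: S_def T_def)
  ultimately obtain n b where n: "n \<noteq> 0" and nS: "\<And>P. P \<in> S \<Longrightarrow> n \<bullet> P \<le> b"
    and nT: "\<And>P. P \<in> T \<Longrightarrow> n \<bullet> P \<ge> b"
    using separating_hyperplane_sets[OF cvxS cvxT] by blast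
  obtain a c where ac: "n = (a, c)" by (metis surj_pair)
  have S: "a \<bullet> y + c * t \<le> b" if "y \<in> U" "p y < t" for y t
    using nS[of "(y, t)"] that by (simp add: S_def ac)
  have T: "b \<le> a \<bullet> y + c * t" if "y \<in> C" "t \<le> p x + q x - q y" for y t
    using nT[of "(y, t)"] that by (simp add: T_def ac)
  have bx: "b \<le> a \<bullet> x + c * p x" using T[OF xC, of "p x"] by simp
  \<comment> \<open>Strict negativity of \<open>c\<close> is what makes the hyperplane a graph.\<close>
  have "c \<le> 0" using S[OF xU, of "p x + 1"] bx by (simp add: algebra_simps)
  moreover have "c \<noteq> 0"
  proof
    assume c: "c = 0"
    obtain e where e: "e > 0" "ball x e \<subseteq> U" using U xU openE by blast
    have "a \<noteq> 0" using n ac c by (auto simp: zero_prod_def)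
    define y where "y = x + (e / (2 * norm a)) *\<^sub>R a"
    have "y \<in> U" using e \<open>a \<noteq> 0\<close> by (intro subsetD[OF e(2)]) (simp add: y_def dist_norm)
    then have "a \<bullet> y \<le> a \<bullet> x" using S[of y "p y + 1"] bx c by simp
    moreover have "a \<bullet> y > a \<bullet> x"
      using e \<open>a \<noteq> 0\<close> by (simp add: y_def inner_add_right)
    ultimately show False by simp
  qed
  ultimately have c: "c < 0" by simp
  have xb: "a \<bullet> x + c * p x \<le> b"
  proof (rule field_le_epsilon)
    fix e :: real assume "e > 0"
    then have "p x < p x - e / c" using c by (simp add: divide_less_0_iff)
    then show "a \<bullet> x + c * p x \<le> b + e"
      using S[OF xU, of "p x - e / c"] c by (simp add: algebra_simps)
  qed
  show thesis
  proof (rule that[of "(- (1 / c)) *\<^sub>R a"])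
    fix y assume y: "y \<in> U"
    show "p x + (- (1 / c)) *\<^sub>R a \<bullet> (y - x) \<le> p y"
    proof (rule dense_ge)
      fix t assume "p y < t"
      then have "a \<bullet> y + c * t \<le> a \<bullet> x + c * p x" using S[OF y] bx by force
      then show "p x + (- (1 / c)) *\<^sub>R a \<bullet> (y - x) \<le> t"
        using c by (simp add: field_simps inner_diff_right)
    qed
  next
    fix y assume y: "y \<in> C"
    have "a \<bullet> x + c * p x \<le> a \<bullet> y + c * (p x + q x - q y)"
      using T[OF y order.refl] xb by linarith
    then show "q x - (- (1 / c)) *\<^sub>R a \<bullet> (y - x) \<le> q y"
      using c by (simp add: field_simps inner_diff_right)
  qed
qed

text \<open>
  Prolong the segment from \<open>y\<close> to \<open>x\<close> beyond \<open>x\<close> by unit length, to \<open>u\<close>. Convexity bounds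
  the decrease of \<open>\<phi>\<close> from \<open>x\<close> to \<open>y\<close> by the distance times its increase from \<open>x\<close> to \<open>u\<close>,
  and \<open>x\<close> and \<open>u\<close> lie in a compact ball whatever \<open>y\<close> is.
\<close>
lemma convex_minorant_on_bounded:
  fixes \<phi> :: "'a::euclidean_space \<Rightarrow> real"
  assumes "convex_on UNIV \<phi>"
  obtains L where "L \<ge> 0" "\<And>x y. norm x \<le> R \<Longrightarrow> \<phi> y \<ge> \<phi> x - L * norm (y - x)"
proof -
  have "continuous_on (cball 0 (R + 1)) \<phi>"
    using convex_on_continuous[OF open_UNIV assms] continuous_on_subset by blast
  then have "bounded (\<phi> ` cball 0 (R + 1))"
    by (intro compact_imp_bounded compact_continuous_image compact_cball)
  then obtain B where "\<forall>x\<in>cball 0 (R + 1). \<bar>\<phi> x\<bar> \<le> B"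
    unfolding bounded_iff by auto
  then have B: "\<And>x. norm x \<le> R + 1 \<Longrightarrow> \<bar>\<phi> x\<bar> \<le> B" by auto
  show thesis
  proof (rule that[of "2 * \<bar>B\<bar>"])
    fix x y :: 'a assume x: "norm x \<le> R"
    show "\<phi> y \<ge> \<phi> x - 2 * \<bar>B\<bar> * norm (y - x)"
    proof (cases "y = x")
      case False
      define d where "d = norm (y - x)"
      have d: "d > 0" using False by (simp add: d_def)
      define u where "u = x - (1 / d) *\<^sub>R (y - x)"
      have "norm u \<le> norm x + norm ((1 / d) *\<^sub>R (y - x))"
        unfolding u_def by (rule norm_triangle_ineq4)
      then have nu: "norm u \<le> R + 1" using x d by (simp add: d_def)
      have "(1 + d) *\<^sub>R x = d *\<^sub>R u + y"
        using d by (simp add: u_def algebra_simps)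
      then have "x = (1 / (1 + d)) *\<^sub>R (d *\<^sub>R u + y)"
        using d by (metis add_pos_pos divide_self_if less_numeral_extra(1) less_irrefl scaleR_one
            scaleR_scaleR times_divide_eq_left mult_1)
      then have x_eq: "x = (d / (1 + d)) *\<^sub>R u + (1 / (1 + d)) *\<^sub>R y"
        by (simp add: scaleR_add_right)
      have "1 - 1 / (1 + d) = d / (1 + d)" using d by (simp add: field_simps)
      then have "\<phi> ((d / (1 + d)) *\<^sub>R u + (1 / (1 + d)) *\<^sub>R y)
          \<le> (d / (1 + d)) * \<phi> u + (1 / (1 + d)) * \<phi> y"
        using convex_onD[OF assms, of "1 / (1 + d)" u y] d by simp
      then have "\<phi> x \<le> (d / (1 + d)) * \<phi> u + (1 / (1 + d)) * \<phi> y"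
        using x_eq by simp
      then have "(1 + d) * \<phi> x \<le> d * \<phi> u + \<phi> y"
        using d by (simp add: add_divide_distrib[symmetric] pos_le_divide_eq mult.commute)
      moreover have "d * (\<phi> u - \<phi> x) \<le> d * (2 * \<bar>B\<bar>)"
        using B[OF nu] B[of x] x d by (intro mult_left_mono) auto
      ultimately show ?thesis
        unfolding d_def[symmetric] by (simp add: algebra_simps)
    qed simp
  qed simp
qed

text \<open>
  Along the segment from \<open>x\<close> to \<open>y\<close>, convexity bounds every difference quotient at \<open>x\<close> by
  \<open>h y - h x\<close>, and the remainder in the local inequality disappears from the quotient in the limit.
\<close>
lemma frechet_subgradient_convex_global:
  assumes h: "ereal_convex h" and g: "g \<in> frechet_subdiff h x"
    and y: "h y \<noteq> -\<infinity>"
  shows "h x + ereal (g \<bullet> (y - x)) \<le> h y"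
proof (cases "y = x \<or> h y = \<infinity>")
  case True
  then show ?thesis by auto
next
  case False
  obtain r where fin: "\<bar>h x\<bar> \<noteq> \<infinity>" and r: "r \<in> o[at x](\<lambda>y. norm (y - x))"
    and ev: "\<forall>\<^sub>F y in at x. h x + ereal (g \<bullet> (y - x) + r y) \<le> h y"
    using g by (auto simp: frechet_subdiff_def)
  obtain a b where a: "h x = ereal a" and b: "h y = ereal b"
    using fin False y by (metis ereal_cases abs_ereal.simps(2,3))
  define d where "d = y - x"
  have d: "norm d > 0" using False by (simp add: d_def)
  have lim: "filterlim (\<lambda>t. x + t *\<^sub>R d) (at x) (at_right (0::real))"
  proof (rule filterlim_atI)
    show "((\<lambda>t. x + t *\<^sub>R d) \<longlongrightarrow> x) (at_right (0::real))"
      by (auto intro!: tendsto_eq_intros)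
    show "\<forall>\<^sub>F t in at_right (0::real). x + t *\<^sub>R d \<noteq> x"
      using d by (auto simp: eventually_at_filter)
  qed
  have "g \<bullet> d \<le> b - a"
  proof (rule field_le_epsilon)
    fix e :: real assume e: "e > 0"
    have "\<forall>\<^sub>F y in at x. norm (r y) \<le> e / norm d * norm (norm (y - x))"
      using landau_o.smallD[OF r, of "e / norm d"] e d by simp
    with ev have "\<forall>\<^sub>F y in at x. h x + ereal (g \<bullet> (y - x) + r y) \<le> h y \<and>
        norm (r y) \<le> e / norm d * norm (norm (y - x))"
      by eventually_elim simp
    from filterlim_iff[THEN iffD1, OF lim, rule_format, OF this]
      eventually_at_right_less[of "0::real"] eventually_at_right_field[of "\<lambda>t. t < 1" "0::real"]
    have "\<forall>\<^sub>F t in at_right (0::real). 0 < t \<and> t < 1 \<and>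
        h x + ereal (g \<bullet> (t *\<^sub>R d) + r (x + t *\<^sub>R d)) \<le> h (x + t *\<^sub>R d) \<and>
        norm (r (x + t *\<^sub>R d)) \<le> e / norm d * norm (norm (t *\<^sub>R d))"
      by (auto elim!: eventually_elim2 intro: exI[of _ "1::real"] simp: eventually_conj_iff)
    then obtain t where t: "0 < t" "t < 1"
        and 1: "h x + ereal (g \<bullet> (t *\<^sub>R d) + r (x + t *\<^sub>R d)) \<le> h (x + t *\<^sub>R d)"
        and 2: "norm (r (x + t *\<^sub>R d)) \<le> e / norm d * norm (norm (t *\<^sub>R d))"
      using eventually_happens'[OF trivial_limit_at_right_real] by blast
    have "x + t *\<^sub>R d = (1 - t) *\<^sub>R x + t *\<^sub>R y" by (simp add: d_def algebra_simps)
    then have "h (x + t *\<^sub>R d) \<le> ereal (1 - t) * h x + ereal t * h y"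
      using h t unfolding ereal_convex_def by simp
    with 1 have "ereal (a + (g \<bullet> (t *\<^sub>R d) + r (x + t *\<^sub>R d))) \<le> ereal ((1 - t) * a + t * b)"
      using a b by (metis order.trans plus_ereal.simps(1) times_ereal.simps(1))
    then have "t * (g \<bullet> d) + r (x + t *\<^sub>R d) \<le> t * (b - a)" by (simp add: algebra_simps)
    moreover have "- r (x + t *\<^sub>R d) \<le> t * e"
      using 2 t d by (simp add: field_simps)
    ultimately have "t * (g \<bullet> d) \<le> t * (b - a + e)" by (simp add: algebra_simps)
    then show "g \<bullet> d \<le> b - a + e" using t by simp
  qed
  then show ?thesis using a b by (simp add: d_def)
qed

section \<open>One step of a convex model\<close>
text \<open>
  The step objective is strongly convex, so it grows at least quadratically away from its minimiser
  \<open>p\<close>: compare \<open>p\<close> with \<open>(1 - t) p + t y\<close>, divide by \<open>t\<close> and let \<open>t\<close> tend to \<open>0\<close>. Finiteness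
  of the model at \<open>p\<close> follows from its finiteness at the competitor \<open>y\<close>.
\<close>
lemma model_step_three_point:
  fixes x :: "'a::euclidean_space"
  assumes h: "ereal_convex (\<lambda>y. m x y s)" and ninf: "\<And>y. m x y s \<noteq> -\<infinity>"
    and X: "convex X" and \<phi>: "convex_on UNIV \<phi>" and a: "a > 0"
    and p: "is_arg_min (model_step_objective m \<phi> a x s) (\<lambda>y. y \<in> X) p"
    and y: "y \<in> X" "m x y s = ereal b"
  obtains c where "m x p s = ereal c"
    and "c + \<phi> p + 1 / (2 * a) * (norm (p - x))\<^sup>2 + 1 / (2 * a) * (norm (p - y))\<^sup>2
          \<le> b + \<phi> y + 1 / (2 * a) * (norm (y - x))\<^sup>2"
proof -
  have pX: "p \<in> X" and pmin: "\<And>z. z \<in> X \<Longrightarrow>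
      model_step_objective m \<phi> a x s p \<le> model_step_objective m \<phi> a x s z"
    using p unfolding is_arg_min_def by (auto simp: not_less)
  have "m x p s \<noteq> \<infinity>"
    using pmin[OF y(1)] y(2) by (auto simp: model_step_objective_def)
  then obtain c where c: "m x p s = ereal c" using ninf[of p] by (cases "m x p s") auto
  define q where "q = (\<lambda>z. 1 / (2 * a) * (norm (z - x))\<^sup>2)"
  define k where "k = 1 / (2 * a)"
  have main: "1 / (2 * a) * (1 - t) * (norm (p - y))\<^sup>2 \<le> b + \<phi> y + q y - (c + \<phi> p + q p)"
    if t: "0 < t" "t < 1" for t
  proof -
    define z where "z = (1 - t) *\<^sub>R p + t *\<^sub>R y"
    have zX: "z \<in> X" unfolding z_def using X pX y(1) t by (intro convexD) auto
    have "m x z s \<le> ereal (1 - t) * m x p s + ereal t * m x y s"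
      unfolding z_def using h t unfolding ereal_convex_def by simp
    then have mz: "m x z s \<le> ereal ((1 - t) * c + t * b)" by (simp add: c y(2))
    then obtain e where e: "m x z s = ereal e" "e \<le> (1 - t) * c + t * b"
      using ninf[of z] by (cases "m x z s") auto
    have \<phi>z: "\<phi> z \<le> (1 - t) * \<phi> p + t * \<phi> y"
      unfolding z_def using \<phi> t unfolding convex_on_def by simp
    have zx: "z - x = (1 - t) *\<^sub>R (p - x) + t *\<^sub>R (y - x)" by (simp add: z_def algebra_simps)
    have "(norm ((1 - t) *\<^sub>R v + t *\<^sub>R w))\<^sup>2 = (1 - t) * (norm v)\<^sup>2 + t * (norm w)\<^sup>2
        - t * (1 - t) * (norm (v - w))\<^sup>2" for v w :: 'a
      unfolding power2_norm_eq_inner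
      by (simp add: inner_add inner_diff inner_commute algebra_simps)
    from this[of "p - x" "y - x"] have zz: "(norm (z - x))\<^sup>2 = (1 - t) * (norm (p - x))\<^sup>2 + t * (norm (y - x))\<^sup>2
        - t * (1 - t) * (norm (p - y))\<^sup>2"
      unfolding zx by simp
    have qz: "q z = (1 - t) * q p + t * q y - t * (1 / (2 * a) * (1 - t) * (norm (p - y))\<^sup>2)"
      unfolding q_def k_def[symmetric] zz by (simp add: algebra_simps)
    have "c + \<phi> p + q p \<le> e + \<phi> z + q z"
      using pmin[OF zX] by (simp add: model_step_objective_def c e q_def)
    with e \<phi>z qz have "t * (1 / (2 * a) * (1 - t) * (norm (p - y))\<^sup>2)
        \<le> t * (b + \<phi> y + q y - (c + \<phi> p + q p))"
      by (simp add: algebra_simps)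
    then show ?thesis using mult_le_cancel_left_pos[OF t(1)] by blast
  qed
  have "1 / (2 * a) * (1 - 0) * (norm (p - y))\<^sup>2 \<le> b + \<phi> y + q y - (c + \<phi> p + q p)"
  proof (rule tendsto_upperbound)
    show "((\<lambda>t. 1 / (2 * a) * (1 - t) * (norm (p - y))\<^sup>2)
        \<longlongrightarrow> 1 / (2 * a) * (1 - 0) * (norm (p - y))\<^sup>2) (at_right (0::real))"
      by (intro tendsto_intros)
    have "\<forall>\<^sub>F t in at_right (0::real). t \<in> {0<..<1}"
      by (rule eventually_at_right_real) simp
    then show "\<forall>\<^sub>F t in at_right (0::real). 1 / (2 * a) * (1 - t) * (norm (p - y))\<^sup>2
        \<le> b + \<phi> y + q y - (c + \<phi> p + q p)"
      by eventually_elim (use main in auto)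
  qed simp
  then show thesis using that[OF c] by (simp add: q_def)
qed

text \<open>
  The competitor \<open>x\<close> itself bounds the length of the step. For another competitor \<open>y\<close>, the linear
  loss \<open>2 a (M + L) n\<close> in the step length \<open>n\<close> is paid by the quadratic gain \<open>n\<^sup>2\<close>, which leaves an
  error of second order in the stepsize.
\<close>
lemma model_step_bounds:
  fixes x :: "'a::euclidean_space"
  assumes h: "ereal_convex (\<lambda>y. m x y s)" and ninf: "\<And>y. m x y s \<noteq> -\<infinity>"
    and X: "convex X" and \<phi>: "convex_on UNIV \<phi>" and a: "a > 0"
    and p: "is_arg_min (model_step_objective m \<phi> a x s) (\<lambda>y. y \<in> X) p"
    and x: "x \<in> X" "m x x s = ereal v"
    and M: "\<And>y. ereal (v - M * norm (y - x)) \<le> m x y s"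
    and L: "\<And>y. \<phi> x - L * norm (y - x) \<le> \<phi> y"
    and nonneg: "M \<ge> 0" "L \<ge> 0"
  shows "norm (p - x) \<le> a * (M + L)"
    and "y \<in> X \<Longrightarrow> m x y s \<le> ereal b \<Longrightarrow>
      (norm (p - y))\<^sup>2 \<le> (norm (y - x))\<^sup>2 + 2 * a * (b + \<phi> y - v - \<phi> x) + a\<^sup>2 * (M + L)\<^sup>2"
proof -
  define n where "n = norm (p - x)"
  obtain c where c: "m x p s = ereal c"
    and "c + \<phi> p + 1 / (2 * a) * n\<^sup>2 + 1 / (2 * a) * n\<^sup>2 \<le> v + \<phi> x + 1 / (2 * a) * (norm (x - x))\<^sup>2"
    using model_step_three_point[OF h ninf X \<phi> a p x] unfolding n_def by metis
  moreover have low: "v - M * n \<le> c" "\<phi> x - L * n \<le> \<phi> p"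
    using M[of p] L[of p] c by (simp_all add: n_def)
  ultimately have "1 / (2 * a) * n\<^sup>2 + 1 / (2 * a) * n\<^sup>2 \<le> (M + L) * n"
    by (simp add: algebra_simps)
  moreover have "1 / (2 * a) * n\<^sup>2 + 1 / (2 * a) * n\<^sup>2 = 1 / a * n\<^sup>2" by simp
  ultimately have "1 / a * n\<^sup>2 \<le> (M + L) * n" by simp
  then have "n * n \<le> (a * (M + L)) * n" using a by (simp add: field_simps power2_eq_square)
  then show "norm (p - x) \<le> a * (M + L)"
    using nonneg a by (cases "n = 0") (auto simp: n_def)
  assume y: "y \<in> X" "m x y s \<le> ereal b"
  then obtain b' where b': "m x y s = ereal b'" "b' \<le> b" using ninf[of y] by (cases "m x y s") auto
  have "c + \<phi> p + 1 / (2 * a) * n\<^sup>2 + 1 / (2 * a) * (norm (p - y))\<^sup>2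
      \<le> b' + \<phi> y + 1 / (2 * a) * (norm (y - x))\<^sup>2"
    using model_step_three_point[OF h ninf X \<phi> a p y(1) b'(1)] c unfolding n_def by auto
  with low b' have "1 / (2 * a) * (norm (p - y))\<^sup>2
      \<le> 1 / (2 * a) * (norm (y - x))\<^sup>2 + (b + \<phi> y - v - \<phi> x) + (M + L) * n - 1 / (2 * a) * n\<^sup>2"
    by (simp add: algebra_simps)
  then have "(2 * a) * (1 / (2 * a) * (norm (p - y))\<^sup>2) \<le> (2 * a) * 
     (1 / (2 * a) * (norm (y - x))\<^sup>2 + (b + \<phi> y - v - \<phi> x) + (M + L) * n - 1 / (2 * a) * n\<^sup>2)"
    using a by (intro mult_left_mono) auto
  then have "(norm (p - y))\<^sup>2 \<le> (norm (y - x))\<^sup>2 + 2 * a * (b + \<phi> y - v - \<phi> x)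
      + (2 * (a * (M + L)) * n - n\<^sup>2)"
    using a by (simp add: algebra_simps)
  moreover have "2 * (a * (M + L)) * n - n\<^sup>2 \<le> a\<^sup>2 * (M + L)\<^sup>2"
    using zero_le_power2[of "a * (M + L) - n"] by (simp add: power2_diff power_mult_distrib)
  ultimately show "(norm (p - y))\<^sup>2 \<le> (norm (y - x))\<^sup>2 + 2 * a * (b + \<phi> y - v - \<phi> x) + a\<^sup>2 * (M + L)\<^sup>2"
    by linarith
qed

section \<open>Slowly varying sequences\<close>
lemma dist_le_sum_steps:
  fixes x :: "nat \<Rightarrow> 'a::metric_space"
  assumes "m \<le> n"
  shows "dist (x m) (x n) \<le> (\<Sum>i=m..<n. dist (x (Suc i)) (x i))"
  using assms
proof (induction n rule: dec_induct)
  case (step n)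
  then show ?case
    using dist_triangle[of "x m" "x (Suc n)" "x n"] by (simp add: dist_commute)
qed simp

text \<open>
  Late on the path \<open>G\<close> cannot be as large as \<open>e\<close>. Since the weights diverge, \<open>G\<close> is below \<open>e / 2\<close> at
  some later time; until then \<open>G\<close> is at least \<open>e / 2\<close>, so the path covers at most \<open>2 / e\<close> times the
  tail of a convergent series, too little for \<open>G\<close> to change by \<open>e / 2\<close>.
\<close>
lemma tendsto_zero_along_path:
  fixes x :: "nat \<Rightarrow> 'a::metric_space"
  assumes K: "\<And>k. x k \<in> K" and G: "uniformly_continuous_on K G" "\<And>k. G (x k) \<ge> (0::real)"
    and a: "\<And>k. a k \<ge> 0" "\<not> summable a"
    and aG: "summable (\<lambda>k. a k * G (x k))"
    and dG: "summable (\<lambda>k. dist (x (Suc k)) (x k) * G (x k))"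
  shows "(\<lambda>k. G (x k)) \<longlonglongrightarrow> 0"
proof (rule LIMSEQ_I)
  fix e :: real assume e: "e > 0"
  obtain d where d: "d > 0"
      "\<And>y z. y \<in> K \<Longrightarrow> z \<in> K \<Longrightarrow> dist z y < d \<Longrightarrow> dist (G z) (G y) < e / 2"
    using G(1) e unfolding uniformly_continuous_on_def by (metis half_gt_zero)
  have freq: "\<exists>k\<ge>n. G (x k) < e / 2" for n
  proof (rule ccontr)
    assume freq: "\<not> ?thesis"
    have "\<And>k. k \<ge> n \<Longrightarrow> norm (a k) \<le> 2 / e * (a k * G (x k))"
    proof -
      fix k assume "k \<ge> n"
      then have "a k * e \<le> a k * (2 * G (x k))"
        using freq a(1) by (intro mult_left_mono) (auto simp: not_less)
      then show "norm (a k) \<le> 2 / e * (a k * G (x k))"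
        using a(1)[of k] e by (simp add: field_simps)
    qed
    then have "summable a"
      using summable_comparison_test'[OF summable_mult[OF aG]] by blast
    then show False using a(2) by simp
  qed
  obtain N where N: "\<And>m n. m \<ge> N \<Longrightarrow>
      norm (\<Sum>i=m..<n. dist (x (Suc i)) (x i) * G (x i)) < e / 2 * d"
    using dG[unfolded summable_Cauchy] e d(1) by (metis half_gt_zero mult_pos_pos)
  have "norm (G (x n) - 0) < e" if n: "n \<ge> N" for n
  proof -
    define k where "k = (LEAST k. k \<ge> n \<and> G (x k) < e / 2)"
    have k: "k \<ge> n" "G (x k) < e / 2" and before: "\<And>i. n \<le> i \<Longrightarrow> i < k \<Longrightarrow> e / 2 \<le> G (x i)"
      using LeastI_ex[of "\<lambda>k. k \<ge> n \<and> G (x k) < e / 2"] freq[of n]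
        not_less_Least[of _ "\<lambda>k. k \<ge> n \<and> G (x k) < e / 2"]
      unfolding k_def by (auto simp: not_less)
    have "e / 2 * dist (x n) (x k) \<le> e / 2 * (\<Sum>i=n..<k. dist (x (Suc i)) (x i))"
      using dist_le_sum_steps[OF k(1)] e by (intro mult_left_mono) auto
    also have "\<dots> \<le> (\<Sum>i=n..<k. dist (x (Suc i)) (x i) * G (x i))"
      unfolding sum_distrib_left
      using before by (intro sum_mono) (metis atLeastLessThan_iff mult.commute mult_left_mono zero_le_dist)
    also have "\<dots> < e / 2 * d" using N[OF n, of k] by simp
    finally have "dist (x n) (x k) < d" using e by simp
    then have "dist (G (x n)) (G (x k)) < e / 2" by (intro d(2) K)
    then show ?thesis using k(2) G(2)[of n] unfolding dist_real_def real_norm_def by linarith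
  qed
  then show "\<exists>N. \<forall>n\<ge>N. norm (G (x n) - 0) < e" by blast
qed

text \<open>
  Increments smaller than \<open>e\<close> cannot jump over an interval of length \<open>2 e\<close> around \<open>c\<close>. A sequence that
  avoids it stays on one side, which pushes its lower limit above \<open>c\<close> or its upper limit below.
\<close>
lemma slow_sequence_visits_between_liminf_limsup:
  fixes a :: "nat \<Rightarrow> real"
  assumes slow: "(\<lambda>k. a (Suc k) - a k) \<longlonglongrightarrow> 0"
    and c: "liminf (\<lambda>k. ereal (a k)) \<le> ereal c" "ereal c \<le> limsup (\<lambda>k. ereal (a k))"
    and e: "e > 0"
  shows "\<exists>k\<ge>n. \<bar>a k - c\<bar> < e"
proof (rule ccontr)
  assume "\<not> ?thesis"
  then have far: "\<And>k. k \<ge> n \<Longrightarrow> \<bar>a k - c\<bar> \<ge> e" by (auto simp: not_less)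
  obtain N where N: "\<And>k. k \<ge> N \<Longrightarrow> \<bar>a (Suc k) - a k\<bar> < e"
    using LIMSEQ_D[OF slow e] by auto
  define m where "m = max n N"
  have side: "(a k \<ge> c + e) = (a m \<ge> c + e)" if "k \<ge> m" for k
    using that
  proof (induction k rule: dec_induct)
    case (step k)
    then show ?case using far[of k] far[of "Suc k"] N[of k] by (auto simp: m_def)
  qed simp
  show False
  proof (cases "a m \<ge> c + e")
    case True
    have "c + e \<le> a k" if "k \<ge> m" for k using side[OF that] True by simp
    then have "ereal (c + e) \<le> liminf (\<lambda>k. ereal (a k))"
      by (intro Liminf_bounded) (auto simp: eventually_sequentially)
    then have "ereal (c + e) \<le> ereal c" using c(1) by (rule order.trans)
    then show False using e by simp
  next
    case False
    have "a k \<le> c - e" if "k \<ge> m" for k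
      using side[OF that] False far[of k] that by (auto simp: m_def)
    then have "limsup (\<lambda>k. ereal (a k)) \<le> ereal (c - e)"
      by (intro Limsup_bounded) (auto simp: eventually_sequentially)
    with c(2) have "ereal c \<le> ereal (c - e)" by (rule order.trans)
    then show False using e by simp
  qed
qed

section \<open>The Moreau envelope\<close>
text \<open>
  The infimum is taken in the reals, so it has its intended meaning when \<open>X\<close> is nonempty and \<open>F\<close> is
  bounded below on \<open>X\<close>.
\<close>
definition moreau_env :: "'a::euclidean_space set \<Rightarrow> ('a \<Rightarrow> real) \<Rightarrow> real \<Rightarrow> 'a \<Rightarrow> real" where
  "moreau_env X F l x = (INF y\<in>X. F y + (norm (y - x))\<^sup>2 / (2 * l))"

context
  fixes X :: "'a::euclidean_space set" and F :: "'a \<Rightarrow> real" and l b :: real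
  assumes X: "X \<noteq> {}" and b: "\<forall>y\<in>X. b \<le> F y" and l: "l > 0"
begin

lemma moreau_env_bdd_below: "bdd_below ((\<lambda>y. F y + (norm (y - x))\<^sup>2 / (2 * l)) ` X)"
  using b l by (intro bdd_belowI2[of _ b]) (simp add: add_increasing2)

lemma moreau_env_le: "y \<in> X \<Longrightarrow> moreau_env X F l x \<le> F y + (norm (y - x))\<^sup>2 / (2 * l)"
  unfolding moreau_env_def by (rule cINF_lower[OF moreau_env_bdd_below])

lemma moreau_env_le_self: "x \<in> X \<Longrightarrow> moreau_env X F l x \<le> F x"
  using moreau_env_le[of x x] by simp

lemma moreau_env_ge: "b \<le> moreau_env X F l x"
  unfolding moreau_env_def using X b l by (intro cINF_greatest) (auto simp: add_increasing2)

lemma moreau_env_near_minimizer: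
  assumes "\<tau> > 0"
  obtains z where "z \<in> X" "F z + (norm (z - x))\<^sup>2 / (2 * l) < moreau_env X F l x + \<tau>"
proof -
  have "\<exists>z\<in>X. F z + (norm (z - x))\<^sup>2 / (2 * l) < moreau_env X F l x + \<tau>"
    using cINF_less_iff[OF X moreau_env_bdd_below, of x "moreau_env X F l x + \<tau>"] assms
    unfolding moreau_env_def by simp
  then show thesis using that by blast
qed

text \<open>
  Expanding the square exhibits \<open>norm x ^ 2 / (2 l)\<close> minus the envelope as a supremum of functions
  that are affine in \<open>x\<close>. It is a finite convex function and therefore continuous.
\<close>
lemma continuous_moreau_env: "continuous_on UNIV (moreau_env X F l)"
proof -
  define q where "q = (\<lambda>x. (norm x)\<^sup>2 / (2 * l) - moreau_env X F l x)"
  have aff: "(norm x)\<^sup>2 / (2 * l) - (F z + (norm (z - x))\<^sup>2 / (2 * l)) = (z \<bullet> x) / l - (norm z)\<^sup>2 / (2 * l) - F z"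
    for x z
    using l by (simp add: power2_norm_eq_inner inner_diff inner_commute field_simps)
  have up: "(z \<bullet> x) / l - (norm z)\<^sup>2 / (2 * l) - F z \<le> q x" if "z \<in> X" for x z
    using moreau_env_le[OF that, of x] aff[of x z] unfolding q_def by linarith
  have "convex_on UNIV q"
    unfolding convex_on_def
  proof (intro conjI ballI allI impI)
    fix x y :: 'a and u v :: real assume uv: "0 \<le> u" "0 \<le> v" "u + v = 1"
    let ?w = "u *\<^sub>R x + v *\<^sub>R y"
    show "q ?w \<le> u * q x + v * q y"
    proof (rule field_le_epsilon)
      fix e :: real assume "e > 0"
      then obtain z where z: "z \<in> X" "F z + (norm (z - ?w))\<^sup>2 / (2 * l) < moreau_env X F l ?w + e"
        using moreau_env_near_minimizer by blast
      have "q ?w \<le> ((z \<bullet> ?w) / l - (norm z)\<^sup>2 / (2 * l) - F z) + e"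
        using z(2) aff[of ?w z] unfolding q_def by linarith
      also have "(z \<bullet> ?w) / l - (norm z)\<^sup>2 / (2 * l) - F z
          = (z \<bullet> ?w) / l - (u + v) * ((norm z)\<^sup>2 / (2 * l) + F z)" using uv by simp
      also have "\<dots> = u * ((z \<bullet> x) / l - (norm z)\<^sup>2 / (2 * l) - F z)
          + v * ((z \<bullet> y) / l - (norm z)\<^sup>2 / (2 * l) - F z)"
        by (simp add: inner_add_right add_divide_distrib algebra_simps)
      also have "\<dots> \<le> u * q x + v * q y"
        using up[OF z(1)] uv by (intro add_mono mult_left_mono)
      finally show "q ?w \<le> u * q x + v * q y + e" by simp
    qed
  qed simp
  then have "continuous_on UNIV q" by (rule convex_on_continuous[OF open_UNIV])
  then have "continuous_on UNIV (\<lambda>x. (norm x)\<^sup>2 / (2 * l) - q x)"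
    using l by (intro continuous_intros) auto
  then show ?thesis by (simp add: q_def)
qed

end

section \<open>Independence of past and present\<close>
text \<open>
  By monotone convergence the series has a finite integral, hence a finite value almost everywhere.
\<close>
lemma AE_summable_if_summable_integrals:
  assumes int: "\<And>k. integrable M (u k)" and nonneg: "\<And>k \<omega>. \<omega> \<in> space M \<Longrightarrow> 0 \<le> u k \<omega>"
    and summ: "summable (\<lambda>k. \<integral>\<omega>. u k \<omega> \<partial>M)"
  shows "AE \<omega> in M. summable (\<lambda>k. u k \<omega> :: real)"
proof -
  have [measurable]: "\<And>k. u k \<in> borel_measurable M" using int by simp
  have "(\<integral>\<^sup>+\<omega>. (\<Sum>k. ennreal (u k \<omega>)) \<partial>M) = (\<Sum>k. \<integral>\<^sup>+\<omega>. ennreal (u k \<omega>) \<partial>M)"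
    by (intro nn_integral_suminf) simp
  also have "\<dots> = (\<Sum>k. ennreal (\<integral>\<omega>. u k \<omega> \<partial>M))"
    using int nonneg by (intro suminf_cong nn_integral_eq_integral) auto
  also have "\<dots> \<noteq> \<infinity>"
    using summ nonneg by (subst suminf_ennreal2) (auto intro!: Bochner_Integration.integral_nonneg)
  finally have "AE \<omega> in M. (\<Sum>k. ennreal (u k \<omega>)) \<noteq> \<infinity>"
    by (intro nn_integral_PInf_AE) auto
  with AE_space show ?thesis
    by eventually_elim (use nonneg in \<open>auto intro!: summable_suminf_not_top\<close>)
qed

lemma space_past_samples [simp]: "space (past_samples M P S k) = space M"
  by (simp add: past_samples_def)

lemma (in prob_space) past_samples_events:
  assumes iv: "indep_vars (\<lambda>_. P) S UNIV"
  shows "sets (past_samples M P S k) \<subseteq> events"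
proof -
  have [measurable]: "\<And>i. S i \<in> measurable M P" using iv unfolding indep_vars_def2 by simp
  have m: "(\<lambda>\<omega>. \<lambda>i\<in>{..<k}. S i \<omega>) \<in> measurable M (\<Pi>\<^sub>M i\<in>{..<k}. P)" by measurable
  then have "(\<lambda>\<omega>. \<lambda>i\<in>{..<k}. S i \<omega>) \<in> space M \<rightarrow> space (\<Pi>\<^sub>M i\<in>{..<k}. P)"
    using measurable_space[OF m] by blast
  then show ?thesis
    unfolding past_samples_def using measurable_sets[OF m] by (auto simp: sets_vimage_algebra2)
qed

lemma (in prob_space) past_samples_mono:
  assumes iv: "indep_vars (\<lambda>_. P) S UNIV" and "j \<le> k"
  shows "sets (past_samples M P S j) \<subseteq> sets (past_samples M P S k)"
proof -
  have S: "\<And>i. S i \<in> measurable M P" using iv unfolding indep_vars_def2 by simp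
  then have sp: "(\<lambda>\<omega>. \<lambda>i\<in>{..<n}. S i \<omega>) \<in> space M \<rightarrow> space (\<Pi>\<^sub>M i\<in>{..<n}. P)" for n
    using measurable_space[OF measurable_restrict[of "{..<n}" S M "\<lambda>_. P"]] by blast
  have res: "(\<lambda>g. restrict g {..<j}) \<in> measurable (\<Pi>\<^sub>M i\<in>{..<k}. P) (\<Pi>\<^sub>M i\<in>{..<j}. P)"
    using \<open>j \<le> k\<close> by (intro measurable_restrict_subset) auto
  show ?thesis
  proof
    fix B assume "B \<in> sets (past_samples M P S j)"
    then obtain C where C: "C \<in> sets (\<Pi>\<^sub>M i\<in>{..<j}. P)" "B = (\<lambda>\<omega>. \<lambda>i\<in>{..<j}. S i \<omega>) -` C \<inter> space M"
      unfolding past_samples_def by (auto simp: sets_vimage_algebra2[OF sp])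
    define D where "D = (\<lambda>g. restrict g {..<j}) -` C \<inter> space (\<Pi>\<^sub>M i\<in>{..<k}. P)"
    have "restrict (\<lambda>i\<in>{..<k}. S i \<omega>) {..<j} = (\<lambda>i\<in>{..<j}. S i \<omega>)" for \<omega>
      using \<open>j \<le> k\<close> by (auto simp: fun_eq_iff)
    then have "B = (\<lambda>\<omega>. \<lambda>i\<in>{..<k}. S i \<omega>) -` D \<inter> space M"
      using sp[of k] by (auto simp: C(2) D_def)
    moreover have "D \<in> sets (\<Pi>\<^sub>M i\<in>{..<k}. P)"
      unfolding D_def using res C(1) by (rule measurable_sets)
    ultimately show "B \<in> sets (past_samples M P S k)"
      unfolding past_samples_def by (auto simp: sets_vimage_algebra2[OF sp])
  qed
qed

text \<open>
  The events of \<open>V\<close> are events of the coordinates below \<open>k\<close>, those of \<open>U (S k)\<close> are events of the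
  coordinate \<open>k\<close>, and disjoint groups of coordinates are independent.
\<close>
lemma (in prob_space) indep_var_past_present:
  assumes iv: "indep_vars (\<lambda>_. P) S UNIV"
    and V: "V \<in> borel_measurable (past_samples M P S k)"
    and U: "(U :: _ \<Rightarrow> 'c::topological_space) \<in> borel_measurable P"
  shows "indep_var borel V borel (\<lambda>\<omega>. U (S k \<omega>))"
proof -
  have S[measurable]: "\<And>i. S i \<in> measurable M P" using iv unfolding indep_vars_def2 by simp
  then have sp: "(\<lambda>\<omega>. \<lambda>i\<in>{..<n}. S i \<omega>) \<in> space M \<rightarrow> space (\<Pi>\<^sub>M i\<in>{..<n}. P)" for n
    using measurable_space[OF measurable_restrict[of "{..<n}" S M "\<lambda>_. P"]] by blast
  let ?past = "\<lambda>\<omega>. \<lambda>i\<in>{..<k}. S i \<omega>"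
  let ?now = "\<lambda>\<omega>. \<lambda>i\<in>{k}. S i \<omega>"
  have "indep_var (\<Pi>\<^sub>M i\<in>{..<k}. P) ?past (\<Pi>\<^sub>M i\<in>{k}. P) ?now"
    by (rule indep_var_restrict[OF iv]) auto
  then have ind: "indep_set
      (sigma_sets (space M) {?past -` B \<inter> space M | B. B \<in> sets (\<Pi>\<^sub>M i\<in>{..<k}. P)})
      (sigma_sets (space M) {?now -` B \<inter> space M | B. B \<in> sets (\<Pi>\<^sub>M i\<in>{k}. P)})"
    and now: "?now \<in> measurable M (\<Pi>\<^sub>M i\<in>{k}. P)"
    unfolding indep_var_eq by auto
  have past: "{V -` B \<inter> space M | B. B \<in> sets borel}
      \<subseteq> {?past -` B \<inter> space M | B. B \<in> sets (\<Pi>\<^sub>M i\<in>{..<k}. P)}"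
    using measurable_sets[OF V] unfolding past_samples_def by (auto simp: sets_vimage_algebra2[OF sp])
  have Uk: "(\<lambda>g. U (g k)) \<in> borel_measurable (\<Pi>\<^sub>M i\<in>{k}. P)"
    using U by measurable
  have present: "{(\<lambda>\<omega>. U (S k \<omega>)) -` B \<inter> space M | B. B \<in> sets borel}
      \<subseteq> {?now -` B \<inter> space M | B. B \<in> sets (\<Pi>\<^sub>M i\<in>{k}. P)}"
  proof clarify
    fix B :: "'c set" assume "B \<in> sets borel"
    then have "(\<lambda>g. U (g k)) -` B \<inter> space (\<Pi>\<^sub>M i\<in>{k}. P) \<in> sets (\<Pi>\<^sub>M i\<in>{k}. P)"
      by (rule measurable_sets[OF Uk])
    moreover have "(\<lambda>\<omega>. U (S k \<omega>)) -` B \<inter> space M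
        = ?now -` ((\<lambda>g. U (g k)) -` B \<inter> space (\<Pi>\<^sub>M i\<in>{k}. P)) \<inter> space M"
      using measurable_space[OF now] by auto
    ultimately show "\<exists>C. (\<lambda>\<omega>. U (S k \<omega>)) -` B \<inter> space M = ?now -` C \<inter> space M
        \<and> C \<in> sets (\<Pi>\<^sub>M i\<in>{k}. P)"
      by blast
  qed
  have "V \<in> borel_measurable M"
    using V past_samples_events[OF iv, of k] unfolding measurable_def by auto
  moreover have "(\<lambda>\<omega>. U (S k \<omega>)) \<in> borel_measurable M"
    by (rule measurable_compose[OF S U])
  moreover have "indep_set (sigma_sets (space M) {V -` B \<inter> space M | B. B \<in> sets borel})
      (sigma_sets (space M) {(\<lambda>\<omega>. U (S k \<omega>)) -` B \<inter> space M | B. B \<in> sets borel})"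
    using ind unfolding indep_set_def
    by (rule indep_sets_mono_sets)
       (use sigma_sets_mono'[OF past] sigma_sets_mono'[OF present] in \<open>auto split: bool.split\<close>)
  ultimately show ?thesis unfolding indep_var_eq by auto
qed

text \<open>
  This replaces conditioning on \<open>H\<close> where \<open>W\<close> is not known to be a measurable function of
  \<open>(Y, T)\<close>. Where \<open>Y\<close> is close to a fixed point \<open>w\<close>, the variable \<open>W\<close> has a bound that depends on \<open>T\<close>
  alone, and the expectation of this bound on an event of \<open>H\<close> factorises. Finitely many such cells
  cover the compact set \<open>K\<close>. They are made disjoint, so the errors, \<open>\<tau>\<close> times the probability of the
  cell, add up to at most \<open>\<tau>\<close>.
\<close>
lemma (in prob_space) expectation_le_by_freezing:
  fixes Y :: "'a \<Rightarrow> 'b::metric_space"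
  assumes H: "space H = space M" "sets H \<subseteq> events"
    and A: "A \<in> sets H" and Y: "Y \<in> borel_measurable H"
    and indep: "\<And>B U. B \<in> sets H \<Longrightarrow> integrable P U \<Longrightarrow>
      integrable M (\<lambda>\<omega>. indicator B \<omega> * U (T \<omega>)) \<and>
      (\<integral>\<omega>. indicator B \<omega> * U (T \<omega>) \<partial>M) = prob B * (\<integral>s. U s \<partial>P)"
    and K: "compact K" "\<And>\<omega>. \<omega> \<in> A \<Longrightarrow> Y \<omega> \<in> K"
    and W: "integrable M (\<lambda>\<omega>. indicator A \<omega> * W \<omega>)"
    and V: "integrable M (\<lambda>\<omega>. indicator A \<omega> * V (Y \<omega>))"
    and cell: "\<And>w \<tau>. w \<in> K \<Longrightarrow> \<tau> > 0 \<Longrightarrow> \<exists>\<rho>>0. \<exists>U. integrable P U \<and>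
      (AE \<omega> in M. \<omega> \<in> A \<longrightarrow> dist w (Y \<omega>) < \<rho> \<longrightarrow> W \<omega> \<le> U (T \<omega>)) \<and>
      (\<forall>x\<in>K. dist w x < \<rho> \<longrightarrow> (\<integral>s. U s \<partial>P) \<le> V x + \<tau>)"
  shows "(\<integral>\<omega>. indicator A \<omega> * W \<omega> \<partial>M) \<le> (\<integral>\<omega>. indicator A \<omega> * V (Y \<omega>) \<partial>M :: real)"
proof (rule field_le_epsilon)
  fix \<tau> :: real assume \<tau>: "\<tau> > 0"
  have ev: "B \<in> events" if "B \<in> sets H" for B using that H by blast
  define Q where "Q w \<rho> U \<longleftrightarrow> integrable P U \<and>
      (AE \<omega> in M. \<omega> \<in> A \<longrightarrow> dist w (Y \<omega>) < \<rho> \<longrightarrow> W \<omega> \<le> U (T \<omega>)) \<and>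
      (\<forall>x\<in>K. dist w x < \<rho> \<longrightarrow> (\<integral>s. U s \<partial>P) \<le> V x + \<tau>)" for w \<rho> U
  have "\<forall>w\<in>K. \<exists>\<rho>>0. \<exists>U. Q w \<rho> U"
    unfolding Q_def using cell[OF _ \<tau>] by blast
  then have "\<exists>\<rho>. \<forall>w\<in>K. \<rho> w > 0 \<and> (\<exists>U. Q w (\<rho> w) U)"
    by (rule bchoice)
  then obtain \<rho> where \<rho>: "\<And>w. w \<in> K \<Longrightarrow> \<rho> w > 0" and "\<forall>w\<in>K. \<exists>U. Q w (\<rho> w) U"
    by blast
  from bchoice[OF this(2)] obtain U where Q: "\<And>w. w \<in> K \<Longrightarrow> Q w (\<rho> w) (U w)"
    by blast
  have U: "\<And>w. w \<in> K \<Longrightarrow> integrable P (U w)"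
    and WU: "\<And>w. w \<in> K \<Longrightarrow> AE \<omega> in M. \<omega> \<in> A \<longrightarrow> dist w (Y \<omega>) < \<rho> w \<longrightarrow> W \<omega> \<le> U w (T \<omega>)"
    and UV: "\<And>w x. w \<in> K \<Longrightarrow> x \<in> K \<Longrightarrow> dist w x < \<rho> w \<Longrightarrow> (\<integral>s. U w s \<partial>P) \<le> V x + \<tau>"
    using Q unfolding Q_def by blast+
  have sub_int: "integrable M (\<lambda>\<omega>. indicator B \<omega> * u \<omega>)"
    if "integrable M (\<lambda>\<omega>. indicator A \<omega> * u \<omega>)" "B \<in> sets H" "B \<subseteq> A" for B and u :: "'a \<Rightarrow> real"
  proof -
    have "integrable M (\<lambda>\<omega>. indicator B \<omega> *\<^sub>R (indicator A \<omega> * u \<omega>))"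
      using that ev by (intro integrable_mult_indicator) auto
    moreover have "indicator B \<omega> *\<^sub>R (indicator A \<omega> * u \<omega>) = indicator B \<omega> * u \<omega>" for \<omega>
      using that(3) by (auto simp: indicator_def)
    ultimately show ?thesis by (simp only:)
  qed
  have cells: "(\<integral>\<omega>. indicator B \<omega> * W \<omega> \<partial>M) \<le> (\<integral>\<omega>. indicator B \<omega> * V (Y \<omega>) \<partial>M) + \<tau> * prob B"
    if "finite C" "C \<subseteq> K" "B \<in> sets H" "B \<subseteq> A" "\<And>\<omega>. \<omega> \<in> B \<Longrightarrow> Y \<omega> \<in> (\<Union>w\<in>C. ball w (\<rho> w))" for B C
    using that
    \<comment> \<open>Each induction step removes one ball from \<open>B\<close>, which makes the cells disjoint.\<close>
  proof (induction C arbitrary: B rule: finite_induct)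
    case empty
    then have "B = {}" by auto
    then show ?case by simp
  next
    case (insert w C)
    have w: "w \<in> K" using insert.prems by simp
    define B1 where "B1 = B \<inter> (Y -` ball w (\<rho> w) \<inter> space H)"
    define B2 where "B2 = B - B1"
    have sets: "B1 \<in> sets H" "B2 \<in> sets H"
      unfolding B1_def B2_def using insert.prems(2) measurable_sets[OF Y, of "ball w (\<rho> w)"] by auto
    have sub: "B1 \<subseteq> A" "B2 \<subseteq> A" using insert.prems(3) by (auto simp: B1_def B2_def)
    have split: "indicator B \<omega> * u = indicator B1 \<omega> * u + indicator B2 \<omega> * u" for \<omega> and u :: real
      by (auto simp: B1_def B2_def indicator_def)
    have BH: "B \<subseteq> space H" using insert.prems(2) sets.sets_into_space by blast
    have 2: "(\<integral>\<omega>. indicator B2 \<omega> * W \<omega> \<partial>M) \<le> (\<integral>\<omega>. indicator B2 \<omega> * V (Y \<omega>) \<partial>M) + \<tau> * prob B2"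
      using insert.prems sets sub BH by (intro insert.IH) (auto simp: B2_def B1_def)
    have ind: "integrable M (indicat_real B1)"
      using ev[OF sets(1)] by (intro integrable_real_indicator) (auto simp: less_top[symmetric])
    have "(\<integral>\<omega>. indicator B1 \<omega> * W \<omega> \<partial>M) \<le> (\<integral>\<omega>. indicator B1 \<omega> * U w (T \<omega>) \<partial>M)"
    proof (rule integral_mono_AE)
      show "AE \<omega> in M. indicator B1 \<omega> * W \<omega> \<le> indicator B1 \<omega> * U w (T \<omega>)"
        using WU[OF w] by eventually_elim (use sub(1) in \<open>auto simp: indicator_def B1_def\<close>)
      show "integrable M (\<lambda>\<omega>. indicator B1 \<omega> * W \<omega>)"
        by (rule sub_int[OF W sets(1) sub(1)])
      show "integrable M (\<lambda>\<omega>. indicator B1 \<omega> * U w (T \<omega>))"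
        using indep[OF sets(1) U[OF w]] by (rule conjunct1)
    qed
    also have "\<dots> = prob B1 * (\<integral>s. U w s \<partial>P)"
      using indep[OF sets(1) U[OF w]] by (rule conjunct2)
    also have "\<dots> = (\<integral>\<omega>. indicator B1 \<omega> * (\<integral>s. U w s \<partial>P) \<partial>M)"
      using ev[OF sets(1)] by simp
    also have "\<dots> \<le> (\<integral>\<omega>. indicator B1 \<omega> * V (Y \<omega>) + \<tau> * indicator B1 \<omega> \<partial>M)"
    proof (rule integral_mono)
      show "indicator B1 \<omega> * (\<integral>s. U w s \<partial>P) \<le> indicator B1 \<omega> * V (Y \<omega>) + \<tau> * indicator B1 \<omega>" for \<omega>
        using UV[OF w, of "Y \<omega>"] K(2) sub(1) by (auto simp: indicator_def B1_def)
    qed (use sub_int[OF V sets(1) sub(1)] ind in auto)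
    also have "\<dots> = (\<integral>\<omega>. indicator B1 \<omega> * V (Y \<omega>) \<partial>M) + \<tau> * prob B1"
      using sub_int[OF V sets(1) sub(1)] ind ev[OF sets(1)] by (subst Bochner_Integration.integral_add) auto
    finally have 1: "(\<integral>\<omega>. indicator B1 \<omega> * W \<omega> \<partial>M) \<le> (\<integral>\<omega>. indicator B1 \<omega> * V (Y \<omega>) \<partial>M) + \<tau> * prob B1" .
    have "B1 \<inter> B2 = {}" "B = B1 \<union> B2" by (auto simp: B1_def B2_def)
    then have "prob B = prob B1 + prob B2"
      using finite_measure_Union[OF ev[OF sets(1)] ev[OF sets(2)]] by simp
    moreover have "(\<integral>\<omega>. indicator B \<omega> * u \<omega> \<partial>M)
        = (\<integral>\<omega>. indicator B1 \<omega> * u \<omega> \<partial>M) + (\<integral>\<omega>. indicator B2 \<omega> * u \<omega> \<partial>M)"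
      if "integrable M (\<lambda>\<omega>. indicator A \<omega> * u \<omega>)" for u :: "'a \<Rightarrow> real"
      unfolding split
      using sub_int[OF that sets(1) sub(1)] sub_int[OF that sets(2) sub(2)]
      by (rule Bochner_Integration.integral_add)
    note this[OF W] this[OF V]
    ultimately show ?case using 1 2 by (simp add: distrib_left)
  qed
  have "K \<subseteq> (\<Union>w\<in>K. ball w (\<rho> w))" using \<rho> centre_in_ball by blast
  then obtain C where C: "C \<subseteq> K" "finite C" "K \<subseteq> (\<Union>w\<in>C. ball w (\<rho> w))"
    using compactE_image[OF K(1), of K "\<lambda>w. ball w (\<rho> w)"] by (metis open_ball)
  have "(\<integral>\<omega>. indicator A \<omega> * W \<omega> \<partial>M) \<le> (\<integral>\<omega>. indicator A \<omega> * V (Y \<omega>) \<partial>M) + \<tau> * prob A"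
    using C(3) K(2) by (intro cells[OF C(2) C(1) A order.refl]) blast
  also have "\<dots> \<le> (\<integral>\<omega>. indicator A \<omega> * V (Y \<omega>) \<partial>M) + \<tau> * 1"
    using \<tau> by (intro add_left_mono mult_left_mono) auto
  finally show "(\<integral>\<omega>. indicator A \<omega> * W \<omega> \<partial>M) \<le> (\<integral>\<omega>. indicator A \<omega> * V (Y \<omega>) \<partial>M) + \<tau>" by simp
qed

section \<open>Objective and stationary points of the model problem\<close>
lemma convex_on_norm_diff_power2:
  fixes x :: "'a::real_inner"
  shows "convex_on UNIV (\<lambda>y. (norm (y - x))\<^sup>2)"
  unfolding convex_on_def
proof (intro conjI ballI allI impI)
  fix y z :: 'a and u v :: real assume uv: "0 \<le> u" "0 \<le> v" "u + v = 1"
  have "u *\<^sub>R y + v *\<^sub>R z - x = u *\<^sub>R (y - x) + v *\<^sub>R (z - x)"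
    using uv by (simp add: algebra_simps flip: scaleR_add_left)
  moreover have "(norm (u *\<^sub>R p + v *\<^sub>R q))\<^sup>2 \<le> u * (norm p)\<^sup>2 + v * (norm q)\<^sup>2" for p q :: 'a
  proof -
    have u: "u = 1 - v" using uv by simp
    have "(norm (u *\<^sub>R p + v *\<^sub>R q))\<^sup>2 = u * (norm p)\<^sup>2 + v * (norm q)\<^sup>2 - u * v * (norm (p - q))\<^sup>2"
      unfolding power2_norm_eq_inner u
      by (simp add: inner_add inner_diff inner_commute algebra_simps)
    then show ?thesis using uv by simp
  qed
  ultimately show "(norm (u *\<^sub>R y + v *\<^sub>R z - x))\<^sup>2 \<le> u * (norm (y - x))\<^sup>2 + v * (norm (z - x))\<^sup>2"
    by simp
qed simp

text \<open>
  A quadratic minorant suffices because a square is a little-o remainder.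
\<close>

lemma frechet_subdiff_realI:
  fixes h :: "'a::euclidean_space \<Rightarrow> real"
  assumes "e > 0" and "\<And>y. y \<in> ball x e \<Longrightarrow> h x + g \<bullet> (y - x) - c * (norm (y - x))\<^sup>2 \<le> h y"
  shows "g \<in> frechet_subdiff_real h x"
proof -
  have lim: "((\<lambda>y. norm (y - x)) \<longlongrightarrow> 0) (at x)" by (auto intro!: tendsto_eq_intros)
  have "(\<lambda>y. - c * (norm (y - x))\<^sup>2) \<in> o[at x](\<lambda>y. norm (y - x))"
  proof (rule smalloI_tendsto)
    have "((\<lambda>y. - c * norm (y - x)) \<longlongrightarrow> - c * 0) (at x)" by (intro tendsto_intros lim)
    then have "((\<lambda>y. - c * norm (y - x)) \<longlongrightarrow> 0) (at x)" by simp
    moreover have "\<forall>\<^sub>F y in at x. - c * norm (y - x) = - c * (norm (y - x))\<^sup>2 / norm (y - x)"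
      by (auto simp: eventually_at_filter power2_eq_square)
    ultimately show "((\<lambda>y. - c * (norm (y - x))\<^sup>2 / norm (y - x)) \<longlongrightarrow> 0) (at x)"
      by (rule Lim_transform_eventually)
    show "\<forall>\<^sub>F y in at x. norm (y - x) \<noteq> 0" by (auto simp: eventually_at_filter)
  qed
  moreover have "\<forall>\<^sub>F y in at x. y \<in> ball x e"
    using assms(1) by (auto simp: eventually_at dist_commute intro: exI[of _ e])
  then have "\<forall>\<^sub>F y in at x. ereal (h x) + ereal (g \<bullet> (y - x) + - c * (norm (y - x))\<^sup>2) \<le> ereal (h y)"
    by eventually_elim (use assms(2) in \<open>force simp: algebra_simps\<close>)
  ultimately show ?thesis
    unfolding frechet_subdiff_def mem_Collect_eq
    by (intro conjI exI[of _ "\<lambda>y. - c * (norm (y - x))\<^sup>2"]) simp_all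
qed

locale stochastic_model = P: prob_space P
  for P :: "'s measure" +
  fixes X :: "'a::euclidean_space set"
    and f :: "'a \<Rightarrow> 's \<Rightarrow> real"
    and m :: "'a \<Rightarrow> 'a \<Rightarrow> 's \<Rightarrow> ereal"
    and \<phi> :: "'a \<Rightarrow> real"
  assumes X_nonempty: "X \<noteq> {}" and X_closed: "closed X" and X_convex: "convex X"
    and \<phi>_convex: "convex_on UNIV \<phi>"
    and f_integrable: "\<And>z. integrable P (f z)"
    and m_not_MInf: "\<And>z y s. z \<in> X \<Longrightarrow> s \<in> space P \<Longrightarrow> m z y s \<noteq> -\<infinity>"
    and lipschitz: "local_lipschitz_cond P X f"
    and weakly_convex: "weak_convexity_cond P X f"
    and m_convex: "model_convex P X m"
    and m_value: "model_value P X f m"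
    and m_subdiff: "model_subdiff P X f m"
    and m_accuracy: "model_accuracy P X f m"
    and coercive: "((\<lambda>z. if z \<in> X then ereal (objective P f \<phi> z) else \<infinity>) \<longlongrightarrow> \<infinity>) at_infinity"
begin

abbreviation F :: "'a \<Rightarrow> real" where
  "F \<equiv> objective P f \<phi>"

abbreviation env :: "real \<Rightarrow> 'a \<Rightarrow> real" where
  "env \<equiv> moreau_env X F"

abbreviation is_step :: "real \<Rightarrow> 'a \<Rightarrow> 's \<Rightarrow> 'a \<Rightarrow> bool" where
  "is_step a x s p \<equiv> is_arg_min (model_step_objective m \<phi> a x s) (\<lambda>y. y \<in> X) p"

lemma model_at_center: "x \<in> X \<Longrightarrow> s \<in> space P \<Longrightarrow> m x x s = ereal (f x s)"
  using m_value unfolding model_value_def by blast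

lemma compact_cball_X: "compact (X \<inter> cball 0 R)"
  using X_closed by (intro closed_Int_compact compact_cball)

text \<open>
  The root of the sum of squares dominates the finitely many local bounds and stays square
  integrable. A local bound may be infinite, but only on a null set of samples.
\<close>
lemma uniform_subgradient_bound:
  assumes "finite C" "C \<subseteq> X"
    and bound: "\<And>c. c \<in> C \<Longrightarrow> subgrad_bound X f \<epsilon> c \<in> borel_measurable P \<and>
      (\<integral>\<^sup>+s. (subgrad_bound X f \<epsilon> c s)\<^sup>2 \<partial>P) < \<infinity>"
  obtains M where "M \<in> borel_measurable P" "\<And>s. 0 \<le> M s" "integrable P (\<lambda>s. (M s)\<^sup>2)"
    "AE s in P. \<forall>c\<in>C. \<forall>y\<in>X. norm (y - c) \<le> \<epsilon> \<longrightarrow>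
      (\<forall>g\<in>frechet_subdiff_real (\<lambda>z. f z s) y. norm g \<le> M s)"
proof -
  let ?b = "subgrad_bound X f \<epsilon>"
  define M where "M = (\<lambda>s. sqrt (\<Sum>c\<in>C. (enn2real (?b c s))\<^sup>2))"
  have meas [measurable]: "\<And>c. c \<in> C \<Longrightarrow> ?b c \<in> borel_measurable P" using bound by blast
  have fin: "AE s in P. ?b c s \<noteq> \<infinity>" if "c \<in> C" for c
  proof -
    have "AE s in P. (?b c s)\<^sup>2 \<noteq> \<infinity>"
      using bound[OF that] meas[OF that] by (intro nn_integral_PInf_AE) auto
    then show ?thesis by eventually_elim (auto simp: power2_eq_square ennreal_mult_eq_top_iff)
  qed
  have sq: "integrable P (\<lambda>s. (enn2real (?b c s))\<^sup>2)" if c: "c \<in> C" for c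
  proof (rule integrableI_bounded)
    show "(\<lambda>s. (enn2real (?b c s))\<^sup>2) \<in> borel_measurable P" using meas[OF c] by measurable
    have "(\<integral>\<^sup>+s. ennreal (norm ((enn2real (?b c s))\<^sup>2)) \<partial>P) \<le> (\<integral>\<^sup>+s. (?b c s)\<^sup>2 \<partial>P)"
      using fin[OF c]
      by (intro nn_integral_mono_AE, eventually_elim)
         (auto simp: ennreal_power[symmetric] ennreal_enn2real_if)
    then show "(\<integral>\<^sup>+s. ennreal (norm ((enn2real (?b c s))\<^sup>2)) \<partial>P) < \<infinity>"
      using bound[OF c] by (simp add: le_less_trans)
  qed
  show thesis
  proof (rule that[of M])
    show "M \<in> borel_measurable P" unfolding M_def by measurable
    show "0 \<le> M s" for s unfolding M_def by (simp add: sum_nonneg)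
    have "(\<lambda>s. (M s)\<^sup>2) = (\<lambda>s. \<Sum>c\<in>C. (enn2real (?b c s))\<^sup>2)"
      unfolding M_def by (simp add: sum_nonneg)
    then show "integrable P (\<lambda>s. (M s)\<^sup>2)" using sq by simp
    have "AE s in P. \<forall>c\<in>C. ?b c s \<noteq> \<infinity>"
      using fin assms(1) by (simp add: AE_finite_all)
    then show "AE s in P. \<forall>c\<in>C. \<forall>y\<in>X. norm (y - c) \<le> \<epsilon> \<longrightarrow>
        (\<forall>g\<in>frechet_subdiff_real (\<lambda>z. f z s) y. norm g \<le> M s)"
    proof eventually_elim
      case (elim s)
      show ?case
      proof (intro ballI impI)
        fix c y g
        assume *: "c \<in> C" "y \<in> X" "norm (y - c) \<le> \<epsilon>" "g \<in> frechet_subdiff_real (\<lambda>z. f z s) y"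
        have "ennreal (norm g) \<le> ?b c s"
          unfolding subgrad_bound_def by (rule SUP_upper2[of y]) (use * in \<open>auto intro: SUP_upper\<close>)
        then have "enn2real (ennreal (norm g)) \<le> enn2real (?b c s)"
          using elim *(1) by (intro enn2real_mono) (auto simp: less_top)
        then have "(norm g)\<^sup>2 \<le> (enn2real (?b c s))\<^sup>2" by (intro power_mono) auto
        also have "\<dots> \<le> (\<Sum>c\<in>C. (enn2real (?b c s))\<^sup>2)"
          using assms(1) *(1) by (intro member_le_sum) auto
        finally show "norm g \<le> M s" unfolding M_def by (rule real_le_rsqrt)
      qed
    qed
  qed
qed

text \<open>
  A subgradient of the convex model at its centre is a subgradient of the sample function, hence at
  most \<open>M\<close> in norm, and it supports the model globally.
\<close>
lemma model_lower_bound: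
  assumes x: "x \<in> X" and s: "s \<in> space P"
    and M: "\<And>g. g \<in> frechet_subdiff_real (\<lambda>z. f z s) x \<Longrightarrow> norm g \<le> M"
  shows "ereal (f x s - M * norm (y - x)) \<le> m x y s"
proof -
  have cvx: "ereal_convex (\<lambda>y. m x y s)"
    and sub: "\<And>y. m x y s < \<infinity> \<Longrightarrow> frechet_subdiff (\<lambda>z. m x z s) y \<noteq> {}"
    using m_convex x s unfolding model_convex_def by auto
  obtain g where g: "g \<in> frechet_subdiff (\<lambda>z. m x z s) x"
    using sub[of x] model_at_center[OF x s] by auto
  then have "norm g \<le> M"
    using M m_subdiff x s unfolding model_subdiff_def by blast
  then have "norm g * norm (y - x) \<le> M * norm (y - x)" by (intro mult_right_mono) auto
  then have "f x s - M * norm (y - x) \<le> f x s + g \<bullet> (y - x)"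
    using Cauchy_Schwarz_ineq2[of g "y - x"] by linarith
  also have "ereal (f x s + g \<bullet> (y - x)) \<le> m x y s"
    using frechet_subgradient_convex_global[OF cvx g m_not_MInf[OF x s]] model_at_center[OF x s]
    by simp
  finally show ?thesis by simp
qed

text \<open>
  Finitely many of the balls on which the hypotheses provide random constants cover the compact
  region of iterates. This gives constants \<open>\<delta>\<close> and \<open>M\<close> that serve all points of the region at once;
  in particular the exceptional null set of samples does not depend on the point. Halving the radius
  keeps \<open>y\<close> in the ball around the centre that is chosen for \<open>x\<close>.
\<close>
lemma local_bounds:
  obtains r \<delta> M where "r > 0"
    and "integrable P \<delta>" "\<And>s. s \<in> space P \<Longrightarrow> 0 \<le> \<delta> s"
    and "M \<in> borel_measurable P" "\<And>s. 0 \<le> M s" "integrable P (\<lambda>s. (M s)\<^sup>2)"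
    and "AE s in P. \<forall>x\<in>X \<inter> cball 0 R. \<forall>y. ereal (f x s - M s * norm (y - x)) \<le> m x y s"
    and "\<And>s x y. s \<in> space P \<Longrightarrow> x \<in> X \<inter> cball 0 R \<Longrightarrow> norm (y - x) \<le> r \<Longrightarrow>
      m x y s \<le> ereal (f y s + \<delta> s / 2 * (norm (y - x))\<^sup>2)"
proof -
  obtain \<epsilon>1 where \<epsilon>1: "\<epsilon>1 > 0" and L: "\<And>\<epsilon> x. 0 < \<epsilon> \<Longrightarrow> \<epsilon> \<le> \<epsilon>1 \<Longrightarrow> x \<in> X \<Longrightarrow>
      subgrad_bound X f \<epsilon> x \<in> borel_measurable P \<and> (\<integral>\<^sup>+s. (subgrad_bound X f \<epsilon> x s)\<^sup>2 \<partial>P) < \<infinity>"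
    using lipschitz unfolding local_lipschitz_cond_def by blast
  obtain \<epsilon>2 where \<epsilon>2: "\<epsilon>2 > 0" and acc: "\<And>\<epsilon>. 0 < \<epsilon> \<Longrightarrow> \<epsilon> \<le> \<epsilon>2 \<Longrightarrow>
      \<forall>c\<in>X. \<exists>\<delta>. integrable P \<delta> \<and> (\<forall>s\<in>space P. \<delta> s \<ge> 0 \<and>
        (\<forall>x \<in> X \<inter> cball c \<epsilon>. \<forall>y \<in> cball c \<epsilon>.
          ereal (f y s) \<ge> m x y s - ereal (1 / 2 * \<delta> s * (norm (y - x))\<^sup>2)))"
    using m_accuracy unfolding model_accuracy_def by blast
  define \<epsilon> where "\<epsilon> = min \<epsilon>1 \<epsilon>2"
  have \<epsilon>: "\<epsilon> > 0" "\<epsilon> \<le> \<epsilon>1" "\<epsilon> \<le> \<epsilon>2" using \<epsilon>1 \<epsilon>2 by (auto simp: \<epsilon>_def)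
  from bchoice[OF acc[OF \<epsilon>(1,3)]] obtain \<delta>' where \<delta>': "\<And>c. c \<in> X \<Longrightarrow> integrable P (\<delta>' c)"
      "\<And>c s. c \<in> X \<Longrightarrow> s \<in> space P \<Longrightarrow> 0 \<le> \<delta>' c s"
      "\<And>c s x y. c \<in> X \<Longrightarrow> s \<in> space P \<Longrightarrow> x \<in> X \<inter> cball c \<epsilon> \<Longrightarrow> y \<in> cball c \<epsilon> \<Longrightarrow>
          m x y s - ereal (1 / 2 * \<delta>' c s * (norm (y - x))\<^sup>2) \<le> ereal (f y s)"
    by blast
  let ?K = "X \<inter> cball 0 R"
  have "?K \<subseteq> (\<Union>c\<in>?K. ball c (\<epsilon> / 2))" using \<epsilon>(1) centre_in_ball[of _ "\<epsilon> / 2"] by force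
  from compactE_image[OF compact_cball_X open_ball this]
  obtain C where C: "C \<subseteq> ?K" "finite C" "?K \<subseteq> (\<Union>c\<in>C. ball c (\<epsilon> / 2))" by metis
  have CX: "C \<subseteq> X" using C(1) by auto
  obtain M where M: "M \<in> borel_measurable P" "\<And>s. 0 \<le> M s" "integrable P (\<lambda>s. (M s)\<^sup>2)"
    "AE s in P. \<forall>c\<in>C. \<forall>y\<in>X. norm (y - c) \<le> \<epsilon> \<longrightarrow>
      (\<forall>g\<in>frechet_subdiff_real (\<lambda>z. f z s) y. norm g \<le> M s)"
    using uniform_subgradient_bound[OF C(2) CX, of \<epsilon>] L[OF \<epsilon>(1,2)] CX by blast
  show thesis
  proof (rule that[of "\<epsilon> / 2" "\<lambda>s. \<Sum>c\<in>C. \<delta>' c s" M])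
    show "integrable P (\<lambda>s. \<Sum>c\<in>C. \<delta>' c s)" using \<delta>'(1) CX by auto
    show "0 \<le> (\<Sum>c\<in>C. \<delta>' c s)" if "s \<in> space P" for s
      using \<delta>'(2) CX that by (intro sum_nonneg) auto
    show "AE s in P. \<forall>x\<in>?K. \<forall>y. ereal (f x s - M s * norm (y - x)) \<le> m x y s"
      using M(4) AE_space
    proof eventually_elim
      case (elim s)
      show ?case
      proof (intro ballI allI)
        fix x y assume x: "x \<in> ?K"
        then obtain c where c: "c \<in> C" "norm (x - c) \<le> \<epsilon>"
          using C(3) \<epsilon>(1) by (fastforce simp: dist_norm norm_minus_commute)
        then show "ereal (f x s - M s * norm (y - x)) \<le> m x y s"
          using elim x by (intro model_lower_bound) auto
      qed
    qed
    show "m x y s \<le> ereal (f y s + (\<Sum>c\<in>C. \<delta>' c s) / 2 * (norm (y - x))\<^sup>2)"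
      if s: "s \<in> space P" and x: "x \<in> ?K" and y: "norm (y - x) \<le> \<epsilon> / 2" for s x y
    proof -
      obtain c where c: "c \<in> C" "dist c x < \<epsilon> / 2" using C(3) x by auto
      have "dist c y \<le> \<epsilon>"
        using dist_triangle[of c y x] c(2) y by (simp add: dist_norm norm_minus_commute)
      then have *: "m x y s - ereal (1 / 2 * \<delta>' c s * (norm (y - x))\<^sup>2) \<le> ereal (f y s)"
        using c CX x s \<epsilon>(1) by (intro \<delta>'(3)) auto
      have "\<delta>' c s \<le> (\<Sum>c\<in>C. \<delta>' c s)"
        using C(2) c(1) \<delta>'(2) CX s by (intro member_le_sum) auto
      then have "\<delta>' c s / 2 * (norm (y - x))\<^sup>2 \<le> (\<Sum>c\<in>C. \<delta>' c s) / 2 * (norm (y - x))\<^sup>2"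
        by (intro mult_right_mono) auto
      with * show ?thesis by (cases "m x y s") auto
    qed
  qed (use \<epsilon> M in auto)
qed

text \<open>
  The model centred at \<open>w\<close> links the values at \<open>w\<close> and \<open>x\<close>. Exchanging the two points turns
  this into a local Lipschitz estimate.
\<close>
lemma sample_lipschitz_from_model:
  assumes "ereal (f w s - M * norm (x - w)) \<le> m w x s"
    and "m w x s \<le> ereal (f x s + d / 2 * (norm (x - w))\<^sup>2)"
  shows "f w s \<le> f x s + M * norm (x - w) + d / 2 * (norm (x - w))\<^sup>2"
  using order.trans[OF assms] by simp

lemma continuous_objective: "continuous_on X F"
proof -
  have "continuous_on X (mean_fun P f)"
    unfolding continuous_on_def
  proof
    fix x assume x: "x \<in> X"
    define R where "R = norm x + 1"
    obtain r \<delta> M where r: "r > 0"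
      and \<delta>: "integrable P \<delta>" "\<And>s. s \<in> space P \<Longrightarrow> 0 \<le> \<delta> s"
      and M: "M \<in> borel_measurable P" "\<And>s. 0 \<le> M s" "integrable P (\<lambda>s. (M s)\<^sup>2)"
      and low: "AE s in P. \<forall>x\<in>X \<inter> cball 0 R. \<forall>y. ereal (f x s - M s * norm (y - x)) \<le> m x y s"
      and up: "\<And>s x y. s \<in> space P \<Longrightarrow> x \<in> X \<inter> cball 0 R \<Longrightarrow> norm (y - x) \<le> r \<Longrightarrow>
        m x y s \<le> ereal (f y s + \<delta> s / 2 * (norm (y - x))\<^sup>2)"
      using local_bounds[of R] by blast
    have M_int: "integrable P M" using P.square_integrable_imp_integrable[OF M(1,3)] .
    define c where "c = (\<lambda>t. (\<integral>s. M s \<partial>P) * t + (\<integral>s. \<delta> s \<partial>P) / 2 * t\<^sup>2)"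
    have le: "mean_fun P f w \<le> mean_fun P f y + c (norm (y - w))"
      if "w \<in> X \<inter> cball 0 R" "norm (y - w) \<le> r" for w y
    proof -
      have "(\<integral>s. f w s \<partial>P) \<le> (\<integral>s. f y s + M s * norm (y - w) + \<delta> s / 2 * (norm (y - w))\<^sup>2 \<partial>P)"
      proof (rule integral_mono_AE)
        show "AE s in P. f w s \<le> f y s + M s * norm (y - w) + \<delta> s / 2 * (norm (y - w))\<^sup>2"
          using low AE_space
        proof eventually_elim
          case (elim s)
          then show ?case
            using up[OF elim(2) that] that(1) by (intro sample_lipschitz_from_model) blast+
        qed
      qed (use f_integrable M_int \<delta> in auto)
      also have "\<dots> = mean_fun P f y + c (norm (y - w))"
        using f_integrable M_int \<delta> by (simp add: mean_fun_def c_def)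
      finally show ?thesis by (simp add: mean_fun_def)
    qed
    have near: "\<forall>\<^sub>F w in at x within X. w \<in> X \<and> norm (w - x) < min r 1"
      using r by (auto simp: eventually_at dist_norm intro!: exI[of _ "min r 1"])
    have lim: "((\<lambda>w. c (norm (w - x))) \<longlongrightarrow> 0) (at x within X)"
      unfolding c_def by (auto intro!: tendsto_eq_intros)
    show "(mean_fun P f \<longlongrightarrow> mean_fun P f x) (at x within X)"
    proof (rule tendsto_sandwich)
      show "\<forall>\<^sub>F w in at x within X. mean_fun P f x - c (norm (w - x)) \<le> mean_fun P f w"
        using near
      proof eventually_elim
        case (elim w)
        then show ?case using le[of x w] x by (simp add: R_def)
      qed
      show "\<forall>\<^sub>F w in at x within X. mean_fun P f w \<le> mean_fun P f x + c (norm (w - x))"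
        using near
      proof eventually_elim
        case (elim w)
        then have "norm w \<le> R" using norm_triangle_sub[of w x] by (simp add: R_def)
        then show ?case using le[of w x] elim by (simp add: norm_minus_commute)
      qed
      show "((\<lambda>w. mean_fun P f x - c (norm (w - x))) \<longlongrightarrow> mean_fun P f x) (at x within X)"
        using tendsto_diff[OF tendsto_const lim] by simp
      show "((\<lambda>w. mean_fun P f x + c (norm (w - x))) \<longlongrightarrow> mean_fun P f x) (at x within X)"
        using tendsto_add[OF tendsto_const lim] by simp
    qed
  qed
  moreover have "continuous_on X \<phi>"
    using convex_on_continuous[OF open_UNIV \<phi>_convex] continuous_on_subset by blast
  ultimately show ?thesis unfolding objective_def by (rule continuous_on_add)
qed

lemma objective_bounded_below:
  obtains b where "\<forall>y\<in>X. b \<le> F y"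
proof -
  obtain B where B: "\<And>z. B \<le> norm z \<Longrightarrow> z \<in> X \<Longrightarrow> 0 < F z"
    using coercive[unfolded tendsto_PInfty, rule_format, of 0]
    unfolding eventually_at_infinity by (auto split: if_splits)
  have "bounded (F ` (X \<inter> cball 0 B))"
    using continuous_on_subset[OF continuous_objective]
    by (intro compact_imp_bounded compact_continuous_image compact_cball_X) auto
  then obtain c where c: "\<forall>z\<in>X \<inter> cball 0 B. \<bar>F z\<bar> \<le> c" unfolding bounded_iff by auto
  have "min 0 (- c) \<le> F y" if "y \<in> X" for y
    using B[of y] bspec[OF c, of y] that by (cases "norm y \<le> B") auto
  then show thesis using that by blast
qed

text \<open>
  Adding a large multiple of the squared distance to \<open>x\<close> makes the mean function convex near \<open>x\<close>
  and, by hypothesis, leaves \<open>x\<close> a minimiser over \<open>X\<close> of the sum with \<open>\<phi>\<close>. Separating first the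
  constraint \<open>X\<close> and then \<open>\<phi>\<close> splits the optimality condition into subgradients; the quadratic
  term has gradient \<open>0\<close> at \<open>x\<close> and drops out.
\<close>
lemma stationary_if_proximal_fixpoint:
  assumes x: "x \<in> X" and l: "l > 0"
    and min: "\<And>y. y \<in> X \<Longrightarrow> F x \<le> F y + (norm (y - x))\<^sup>2 / (2 * l)"
  shows "x \<in> stationary_set P X f \<phi>"
proof -
  obtain \<epsilon> lam where \<epsilon>: "\<epsilon> > 0" and lam: "integrable P lam"
    and cvx: "\<And>s. s \<in> space P \<Longrightarrow> convex_on (cball x \<epsilon>) (\<lambda>y. f y s + lam s / 2 * (norm (y - x))\<^sup>2)"
    using weakly_convex x unfolding weak_convexity_cond_def by (meson order_refl)
  define D where "D = (\<integral>s. lam s \<partial>P)"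
  \<comment> \<open>Large enough both for convexity and for the minimality of \<open>x\<close>.\<close>
  define c where "c = max D (1 / l)"
  define h where "h = (\<lambda>y. mean_fun P f y + c / 2 * (norm (y - x))\<^sup>2)"
  have "convex_on (ball x \<epsilon>) (\<lambda>y. mean_fun P f y + D / 2 * (norm (y - x))\<^sup>2)"
    unfolding convex_on_def
  proof (intro conjI ballI allI impI convex_ball)
    fix y z and u v :: real
    assume yz: "y \<in> ball x \<epsilon>" "z \<in> ball x \<epsilon>" and uv: "0 \<le> u" "0 \<le> v" "u + v = 1"
    let ?w = "u *\<^sub>R y + v *\<^sub>R z"
    have "(\<integral>s. f ?w s + lam s / 2 * (norm (?w - x))\<^sup>2 \<partial>P)
        \<le> (\<integral>s. u * (f y s + lam s / 2 * (norm (y - x))\<^sup>2) + v * (f z s + lam s / 2 * (norm (z - x))\<^sup>2) \<partial>P)"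
    proof (rule integral_mono)
      fix s assume "s \<in> space P"
      from cvx[OF this, unfolded convex_on_def, THEN conjunct2, rule_format, of y z u v] yz uv
      show "f ?w s + lam s / 2 * (norm (?w - x))\<^sup>2
          \<le> u * (f y s + lam s / 2 * (norm (y - x))\<^sup>2) + v * (f z s + lam s / 2 * (norm (z - x))\<^sup>2)"
        by simp
    qed (use f_integrable lam in auto)
    then show "mean_fun P f ?w + D / 2 * (norm (?w - x))\<^sup>2
        \<le> u * (mean_fun P f y + D / 2 * (norm (y - x))\<^sup>2) + v * (mean_fun P f z + D / 2 * (norm (z - x))\<^sup>2)"
      using f_integrable lam by (simp add: mean_fun_def D_def)
  qed
  moreover have "convex_on (ball x \<epsilon>) (\<lambda>y. (c - D) / 2 * (norm (y - x))\<^sup>2)"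
    by (intro convex_on_cmul convex_on_subset[OF convex_on_norm_diff_power2]) (auto simp: c_def)
  ultimately have "convex_on (ball x \<epsilon>)
      (\<lambda>y. mean_fun P f y + D / 2 * (norm (y - x))\<^sup>2 + (c - D) / 2 * (norm (y - x))\<^sup>2)"
    by (rule convex_on_add)
  moreover have "mean_fun P f y + D / 2 * (norm (y - x))\<^sup>2 + (c - D) / 2 * (norm (y - x))\<^sup>2 = h y" for y
    by (simp add: h_def field_simps)
  ultimately have h: "convex_on (ball x \<epsilon>) h" by simp
  have \<phi>: "convex_on (ball x \<epsilon>) \<phi>" by (rule convex_on_subset[OF \<phi>_convex]) auto
  have hx: "h x = mean_fun P f x" by (simp add: h_def)
  have lc: "1 / l \<le> c" by (simp add: c_def)
  obtain g where g: "\<And>y. y \<in> ball x \<epsilon> \<Longrightarrow> (h x + \<phi> x) + g \<bullet> (y - x) \<le> h y + \<phi> y"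
    and gX: "\<And>y. y \<in> X \<Longrightarrow> 0 - g \<bullet> (y - x) \<le> 0"
  proof (rule convex_sandwich[where p = "\<lambda>y. h y + \<phi> y" and q = "\<lambda>_. 0" and C = X and x = x])
    show "convex_on (ball x \<epsilon>) (\<lambda>y. h y + \<phi> y)" by (rule convex_on_add[OF h \<phi>])
    show "convex_on X (\<lambda>_. 0 :: real)" using X_convex by (simp add: convex_on_def)
    fix y assume "y \<in> ball x \<epsilon>" "y \<in> X"
    have "1 / l * ((norm (y - x))\<^sup>2 / 2) \<le> c * ((norm (y - x))\<^sup>2 / 2)"
      using lc by (intro mult_right_mono) auto
    then show "h x + \<phi> x + 0 \<le> h y + \<phi> y + 0"
      using min[OF \<open>y \<in> X\<close>] by (simp add: h_def objective_def)
  qed (use x \<epsilon> in auto)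
  obtain w where w: "\<And>y. y \<in> ball x \<epsilon> \<Longrightarrow> (h x - g \<bullet> (x - x)) + w \<bullet> (y - x) \<le> h y - g \<bullet> (y - x)"
    and w\<phi>: "\<And>y. \<phi> x - w \<bullet> (y - x) \<le> \<phi> y"
  proof (rule convex_sandwich[where U = "ball x \<epsilon>" and p = "\<lambda>y. h y - g \<bullet> (y - x)" and q = \<phi> and C = UNIV and x = x])
    have "convex_on (ball x \<epsilon>) (\<lambda>y. - (g \<bullet> (y - x)))"
      unfolding convex_on_def
    proof (intro conjI ballI allI impI convex_ball)
      fix y z and u v :: real assume "u + v = 1"
      then have "g \<bullet> x = u * (g \<bullet> x) + v * (g \<bullet> x)" by (simp flip: distrib_right)
      then show "- (g \<bullet> (u *\<^sub>R y + v *\<^sub>R z - x)) \<le> u * - (g \<bullet> (y - x)) + v * - (g \<bullet> (z - x))"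
        by (simp add: inner_diff_right inner_add_right algebra_simps)
    qed
    from convex_on_add[OF h this] show "convex_on (ball x \<epsilon>) (\<lambda>y. h y - g \<bullet> (y - x))" by simp
    show "convex_on UNIV \<phi>" by (rule \<phi>_convex)
    fix y assume "y \<in> ball x \<epsilon>"
    then show "h x - g \<bullet> (x - x) + \<phi> x \<le> h y - g \<bullet> (y - x) + \<phi> y" using g[of y] by simp
  qed (use \<epsilon> in auto)
  have "g + w \<in> frechet_subdiff_real (mean_fun P f) x"
  proof (rule frechet_subdiff_realI[OF \<epsilon>])
    fix y assume "y \<in> ball x \<epsilon>"
    then show "mean_fun P f x + (g + w) \<bullet> (y - x) - c / 2 * (norm (y - x))\<^sup>2 \<le> mean_fun P f y"
      using w[of y] by (simp add: h_def inner_add_left)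
  qed
  moreover have "- w \<in> frechet_subdiff_real \<phi> x"
    using w\<phi> by (intro frechet_subdiff_realI[OF \<epsilon>, where c = 0]) auto
  moreover have "(g + w) + (- w) = g" by simp
  ultimately have "g \<in> {u + v | u v. u \<in> frechet_subdiff_real (mean_fun P f) x \<and> v \<in> frechet_subdiff_real \<phi> x}"
    by (metis (mono_tags, lifting) mem_Collect_eq)
  then show ?thesis unfolding stationary_set_def using gX x by force
qed

section \<open>Expected decrease of the envelope\<close>
lemma bounded_on_iterate_region:
  assumes "continuous_on X h"
  obtains B where "\<And>x. x \<in> X \<inter> cball 0 R \<Longrightarrow> \<bar>h x\<bar> \<le> (B :: real)"
proof -
  have "bounded (h ` (X \<inter> cball 0 R))"
    using continuous_on_subset[OF assms]
    by (intro compact_imp_bounded compact_continuous_image compact_cball_X) auto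
  then obtain B where "\<forall>x\<in>X \<inter> cball 0 R. \<bar>h x\<bar> \<le> B" unfolding bounded_iff by auto
  then show thesis using that by blast
qed

lemma continuous_env:
  assumes "l > 0"
  shows "continuous_on UNIV (env l)"
proof -
  obtain b where "\<forall>y\<in>X. b \<le> F y" using objective_bounded_below by blast
  then show ?thesis by (rule continuous_moreau_env[OF X_nonempty _ assms])
qed

lemma step_bounds:
  assumes x: "x \<in> X" and s: "s \<in> space P" and a: "a > 0" and step: "is_step a x s p"
    and M: "\<And>y. ereal (f x s - M * norm (y - x)) \<le> m x y s" "0 \<le> M"
    and L: "\<And>y. \<phi> x - L * norm (y - x) \<le> \<phi> y" "0 \<le> L"
  shows "norm (p - x) \<le> a * (M + L)"
    and "y \<in> X \<Longrightarrow> m x y s \<le> ereal b \<Longrightarrow> (norm (p - y))\<^sup>2 \<le>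
      (norm (y - x))\<^sup>2 + 2 * a * (b + \<phi> y - f x s - \<phi> x) + a\<^sup>2 * (M + L)\<^sup>2"
proof -
  have "ereal_convex (\<lambda>y. m x y s)" using m_convex x s unfolding model_convex_def by blast
  note * = this m_not_MInf[OF x s] X_convex \<phi>_convex a step x model_at_center[OF x s] M(1) L(1) M(2) L(2)
  show "norm (p - x) \<le> a * (M + L)"
    by (rule model_step_bounds(1)[where m = m and x = x and s = s and \<phi> = \<phi> and v = "f x s", OF *])
  show "(norm (p - y))\<^sup>2 \<le> (norm (y - x))\<^sup>2 + 2 * a * (b + \<phi> y - f x s - \<phi> x) + a\<^sup>2 * (M + L)\<^sup>2"
    if "y \<in> X" "m x y s \<le> ereal b"
    by (rule model_step_bounds(2)[where m = m and x = x and s = s and \<phi> = \<phi> and v = "f x s", OF * that])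
qed

text \<open>
  The central estimate. Let \<open>z\<close> be a near-minimiser of \<open>F y + norm (y - w) ^ 2 / (2 l)\<close> over \<open>X\<close>.
  Using \<open>z\<close> as competitor in the step from \<open>x\<close> to \<open>p\<close>, and bounding the model at \<open>z\<close> by \<open>f\<close> and
  the accuracy constant, gives after taking the mean
  \<open>E (norm (p - z) ^ 2) \<le> norm (x - z) ^ 2 + 2 a (F z - F x + D * norm (x - z) ^ 2 / 2) + a\<^sup>2 * E (N\<^sup>2)\<close>,
  where \<open>D\<close> is the mean accuracy constant.
  Since the envelope at \<open>p\<close> is at most \<open>F z + norm (z - p) ^ 2 / (2 l)\<close>, and since \<open>l\<close> is so small that
  \<open>F z\<close> plus the accuracy term exceeds the envelope at \<open>x\<close> by a small error only, the envelope decreases in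
  mean by \<open>a / l\<close> times its gap to \<open>F\<close>, up to \<open>C a\<^sup>2\<close>.

  The bound \<open>U\<close> must be a function of the sample alone for a whole neighbourhood of \<open>w\<close>. Hence \<open>z\<close> is
  attached to \<open>w\<close> and not to \<open>x\<close>, and every occurrence of \<open>x\<close> is estimated by its distance \<open>\<rho>\<close> from
  \<open>w\<close>; the resulting error tends to \<open>0\<close> with \<open>\<rho>\<close>.
\<close>
lemma one_step_descent:
  obtains l C N where "l > 0" "C \<ge> 0"
    and "N \<in> borel_measurable P" "\<And>s. 0 \<le> N s" "integrable P (\<lambda>s. (N s)\<^sup>2)"
    and "AE s in P. \<forall>x\<in>X \<inter> cball 0 R. \<forall>a>0. \<forall>p. is_step a x s p \<longrightarrow> norm (p - x) \<le> a * N s"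
    and "\<And>w \<tau> a. w \<in> X \<inter> cball 0 R \<Longrightarrow> \<tau> > 0 \<Longrightarrow> a > 0 \<Longrightarrow> \<exists>\<rho>>0. \<exists>U. integrable P U \<and>
      (AE s in P. \<forall>x\<in>X \<inter> cball 0 R. dist w x < \<rho> \<longrightarrow> (\<forall>p. is_step a x s p \<longrightarrow> env l p \<le> U s)) \<and>
      (\<forall>x\<in>X \<inter> cball 0 R. dist w x < \<rho> \<longrightarrow>
        (\<integral>s. U s \<partial>P) \<le> env l x - a / l * (F x - env l x) + C * a\<^sup>2 + \<tau>)"
proof -
  let ?K = "X \<inter> cball 0 R"
  obtain r \<delta> M where r: "r > 0"
    and \<delta>: "integrable P \<delta>" "\<And>s. s \<in> space P \<Longrightarrow> 0 \<le> \<delta> s"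
    and M: "M \<in> borel_measurable P" "\<And>s. 0 \<le> M s" "integrable P (\<lambda>s. (M s)\<^sup>2)"
    and low: "AE s in P. \<forall>x\<in>?K. \<forall>y. ereal (f x s - M s * norm (y - x)) \<le> m x y s"
    and up: "\<And>s x y. s \<in> space P \<Longrightarrow> x \<in> ?K \<Longrightarrow> norm (y - x) \<le> r \<Longrightarrow>
      m x y s \<le> ereal (f y s + \<delta> s / 2 * (norm (y - x))\<^sup>2)"
    using local_bounds[of R] by blast
  have M_int: "integrable P M" using P.square_integrable_imp_integrable[OF M(1,3)] .
  obtain L where L: "L \<ge> 0" "\<And>x y. norm x \<le> R \<Longrightarrow> \<phi> y \<ge> \<phi> x - L * norm (y - x)"
    using convex_minorant_on_bounded[OF \<phi>_convex, of R] by blast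
  obtain b where b: "\<forall>y\<in>X. b \<le> F y" using objective_bounded_below by blast
  obtain B where B: "\<And>x. x \<in> ?K \<Longrightarrow> \<bar>F x\<bar> \<le> B"
    using bounded_on_iterate_region[OF continuous_objective, of R] by blast
  define D where "D = (\<integral>s. \<delta> s \<partial>P)"
  have D: "D \<ge> 0" unfolding D_def using \<delta>(2) by (intro Bochner_Integration.integral_nonneg)
  \<comment> \<open>\<open>Q\<close> bounds \<open>F w + 1 - F z\<close>. The first bound on \<open>l\<close> lets the proximal term absorb the model
    error, the second keeps \<open>z\<close> within \<open>r / 2\<close> of \<open>w\<close>, where the model is accurate.\<close>
  define Q where "Q = \<bar>B\<bar> + 1 + \<bar>b\<bar>"
  have Q: "Q > 0" by (simp add: Q_def)
  define l where "l = min (1 / (D + 1)) (r\<^sup>2 / (8 * Q))"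
  have l: "l > 0" using D Q r by (simp add: l_def)
  have "l \<le> 1 / (D + 1)" by (simp add: l_def)
  then have lD: "D \<le> 1 / l" using l D by (simp add: field_simps)
  have "l \<le> r\<^sup>2 / (8 * Q)" by (simp add: l_def)
  then have lQ: "2 * l * Q \<le> (r / 2)\<^sup>2" using Q by (simp add: field_simps power2_eq_square)
  define N where "N = (\<lambda>s. M s + L)"
  have N_sq: "integrable P (\<lambda>s. (N s)\<^sup>2)"
    unfolding N_def power2_sum using M M_int by simp
  define C where "C = (\<integral>s. (N s)\<^sup>2 \<partial>P) / (2 * l)"
  have C: "C \<ge> 0" unfolding C_def using l by simp
  note env_facts = X_nonempty b l
  have cont_env: "continuous_on X (env l)" using continuous_env[OF l] continuous_on_subset by blast
  show thesis
  proof (rule that[of l C N])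
    show "AE s in P. \<forall>x\<in>?K. \<forall>a>0. \<forall>p. is_step a x s p \<longrightarrow> norm (p - x) \<le> a * N s"
      using low AE_space
    proof eventually_elim
      case (elim s)
      show ?case
      proof (intro ballI allI impI)
        fix x a p assume x: "x \<in> ?K" and a: "0 < a" and p: "is_step a x s p"
        show "norm (p - x) \<le> a * N s"
          unfolding N_def by (rule step_bounds(1)[OF _ elim(2) a p]) (use x elim(1) M(2) L in auto)
      qed
    qed
  next
    fix w \<tau> a assume w: "w \<in> ?K" and \<tau>: "(\<tau>::real) > 0" and a: "(a::real) > 0"
    define H where "H = (\<lambda>x. env l x - a / l * (F x - env l x) + C * a\<^sup>2)"
    have "continuous_on X H" unfolding H_def by (intro continuous_intros continuous_objective cont_env)
    then obtain \<rho>1 where \<rho>1: "\<rho>1 > 0" "\<And>x. x \<in> X \<Longrightarrow> dist x w < \<rho>1 \<Longrightarrow> dist (H x) (H w) < \<tau> / 3"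
      using w \<tau> unfolding continuous_on_iff by (metis IntD1 divide_pos_pos zero_less_numeral)
    \<comment> \<open>The slack \<open>\<tau>'\<close> of \<open>z\<close> enters the final bound with the factor \<open>1 + a / l\<close>. One third of \<open>\<tau>\<close>
      goes to it, one to \<open>\<rho> > 0\<close>, one to replacing \<open>w\<close> by \<open>x\<close>.\<close>
    define \<tau>' where "\<tau>' = min 1 (\<tau> / (3 * (1 + a / l)))"
    have al: "a / l > 0" using a l by simp
    have \<tau>': "\<tau>' > 0" "\<tau>' \<le> 1" using \<tau> al by (auto simp: \<tau>'_def)
    have "\<tau>' \<le> \<tau> / (3 * (1 + a / l))" by (simp add: \<tau>'_def)
    then have "\<tau>' * (3 * (1 + a / l)) \<le> \<tau>" using al by (subst (asm) pos_le_divide_eq) auto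
    moreover have "v * u \<le> \<tau> / 3" if "u * (3 * v) \<le> \<tau>" for u v :: real
      using that by (simp add: algebra_simps)
    ultimately have \<tau>'_small: "(1 + a / l) * \<tau>' \<le> \<tau> / 3" by blast
    obtain z where z: "z \<in> X" "F z + (norm (z - w))\<^sup>2 / (2 * l) < env l w + \<tau>'"
      using moreau_env_near_minimizer[OF env_facts \<tau>'(1)] by metis
    define n where "n = norm (z - w)"
    have "n\<^sup>2 / (2 * l) \<le> Q"
      using z(2) bspec[OF b z(1)] moreau_env_le_self[OF env_facts, of w] w B[OF w] \<tau>'
      unfolding n_def[symmetric] Q_def by (auto split: abs_split)
    then have "n\<^sup>2 \<le> 2 * l * Q" using l by (simp add: field_simps)
    then have n: "n \<le> r / 2" using lQ r by (meson order.trans power2_le_imp_le half_gt_zero less_imp_le)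
    define q where "q = (\<lambda>\<rho> s. (n + \<rho>)\<^sup>2 + 2 * a * (f z s + \<delta> s / 2 * (n + \<rho>)\<^sup>2 + \<phi> z
        - f w s + M s * \<rho> + \<delta> s / 2 * \<rho>\<^sup>2 - \<phi> w + L * \<rho>) + a\<^sup>2 * (N s)\<^sup>2)"
    define U where "U = (\<lambda>\<rho> s. F z + q \<rho> s / (2 * l))"
    \<comment> \<open>The mean of \<open>U \<rho>\<close>.\<close>
    define \<psi> where "\<psi> = (\<lambda>\<rho>. F z + ((n + \<rho>)\<^sup>2 + 2 * a * (F z + D / 2 * (n + \<rho>)\<^sup>2
        - F w + (\<integral>s. M s \<partial>P) * \<rho> + D / 2 * \<rho>\<^sup>2 + L * \<rho>) + a\<^sup>2 * (2 * l * C)) / (2 * l))"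
    have q_int: "integrable P (q \<rho>)" for \<rho>
      unfolding q_def using f_integrable \<delta>(1) M_int N_sq by simp
    have U_int: "integrable P (U \<rho>)" for \<rho>
      unfolding U_def using q_int by simp
    have U_mean: "(\<integral>s. U \<rho> s \<partial>P) = \<psi> \<rho>" for \<rho>
    proof -
      have "(\<integral>s. q \<rho> s \<partial>P) = (n + \<rho>)\<^sup>2 + 2 * a * (F z + D / 2 * (n + \<rho>)\<^sup>2
        - F w + (\<integral>s. M s \<partial>P) * \<rho> + D / 2 * \<rho>\<^sup>2 + L * \<rho>) + a\<^sup>2 * (2 * l * C)"
        unfolding q_def using f_integrable \<delta>(1) M_int N_sq l
        by (simp add: objective_def mean_fun_def D_def C_def P.prob_space)
      then show ?thesis unfolding U_def \<psi>_def using q_int[of \<rho>] by (simp add: P.prob_space)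
    qed
    have "(\<psi> \<longlongrightarrow> \<psi> 0) (at_right 0)" unfolding \<psi>_def using l by (intro tendsto_intros) auto
    then have "\<forall>\<^sub>F \<rho> in at_right 0. \<psi> \<rho> < \<psi> 0 + \<tau> / 3"
      using \<tau> by (intro order_tendstoD(2)) auto
    moreover have "\<forall>\<^sub>F \<rho> in at_right (0::real). \<rho> \<in> {0<..<min \<rho>1 (r / 2)}"
      using \<rho>1(1) r by (intro eventually_at_right_real) auto
    ultimately have "\<forall>\<^sub>F \<rho> in at_right (0::real). \<psi> \<rho> < \<psi> 0 + \<tau> / 3 \<and> \<rho> \<in> {0<..<min \<rho>1 (r / 2)}"
      by (rule eventually_conj)
    then obtain \<rho> where \<psi>\<rho>: "\<psi> \<rho> < \<psi> 0 + \<tau> / 3" and \<rho>: "0 < \<rho>" "\<rho> < \<rho>1" "\<rho> < r / 2"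
      using eventually_happens'[OF trivial_limit_at_right_real] by fastforce
    have \<psi>0: "\<psi> 0 \<le> H w + \<tau> / 3"
    proof -
      define e where "e = n\<^sup>2 / (2 * l)"
      have ez: "F z + e \<le> env l w + \<tau>'" using z(2) by (simp add: e_def n_def)
      have "D / 2 * n\<^sup>2 \<le> (1 / l) / 2 * n\<^sup>2" using lD by (intro mult_right_mono divide_right_mono) auto
      then have De: "D / 2 * n\<^sup>2 \<le> e" by (simp add: e_def)
      have "\<psi> 0 = F z + e + a / l * (F z + D / 2 * n\<^sup>2 - F w) + C * a\<^sup>2"
        unfolding \<psi>_def e_def using l by (simp add: field_simps power2_eq_square)
      also have "\<dots> \<le> (env l w + \<tau>') + a / l * (env l w + \<tau>' - F w) + C * a\<^sup>2"
      proof -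
        have "a / l * (F z + D / 2 * n\<^sup>2 - F w) \<le> a / l * (env l w + \<tau>' - F w)"
          using ez De al by (intro mult_left_mono) auto
        with ez show ?thesis by linarith
      qed
      also have "\<dots> = H w + (1 + a / l) * \<tau>'" by (simp add: H_def algebra_simps)
      finally show ?thesis using \<tau>'_small by linarith
    qed
    have below: "AE s in P. \<forall>x\<in>?K. dist w x < \<rho> \<longrightarrow> (\<forall>p. is_step a x s p \<longrightarrow> env l p \<le> U \<rho> s)"
      using low AE_space
    proof eventually_elim
      case (elim s)
      show ?case
      proof (intro ballI allI impI)
        fix x p assume x: "x \<in> ?K" and wx: "dist w x < \<rho>" and p: "is_step a x s p"
        have \<delta>s: "0 \<le> \<delta> s" using \<delta>(2) elim(2) .
        have xw: "norm (x - w) \<le> \<rho>" using wx by (simp add: dist_norm norm_minus_commute)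
        have zx: "norm (z - x) \<le> n + \<rho>"
          using norm_triangle_ineq[of "z - w" "w - x"] wx by (simp add: n_def dist_norm)
        have zxr: "norm (z - x) \<le> r" using zx n \<rho> by simp
        have "(norm (p - z))\<^sup>2 \<le> (norm (z - x))\<^sup>2
            + 2 * a * ((f z s + \<delta> s / 2 * (norm (z - x))\<^sup>2) + \<phi> z - f x s - \<phi> x) + a\<^sup>2 * (M s + L)\<^sup>2"
          by (rule step_bounds(2)[OF _ elim(2) a p])
            (use x elim L M(2) z(1) up[OF elim(2) x zxr] in auto)
        also have "\<dots> \<le> q \<rho> s"
        proof -
          have sq: "(norm (z - x))\<^sup>2 \<le> (n + \<rho>)\<^sup>2" using zx by (intro power_mono) auto
          have sq': "(norm (x - w))\<^sup>2 \<le> \<rho>\<^sup>2" using xw by (intro power_mono) auto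
          have "f w s \<le> f x s + M s * norm (x - w) + \<delta> s / 2 * (norm (x - w))\<^sup>2"
            using elim w xw \<rho> up[OF elim(2) w, of x] by (intro sample_lipschitz_from_model) auto
          also have "\<dots> \<le> f x s + M s * \<rho> + \<delta> s / 2 * \<rho>\<^sup>2"
            using xw sq' M(2) \<delta>s by (intro add_mono mult_left_mono) auto
          finally have fw: "f w s \<le> f x s + M s * \<rho> + \<delta> s / 2 * \<rho>\<^sup>2" .
          have "L * norm (x - w) \<le> L * \<rho>" using xw L(1) by (rule mult_left_mono)
          then have "\<phi> w \<le> \<phi> x + L * \<rho>" using L(2)[of w x] w by auto
          moreover have "\<delta> s / 2 * (norm (z - x))\<^sup>2 \<le> \<delta> s / 2 * (n + \<rho>)\<^sup>2"
            using sq \<delta>s by (intro mult_left_mono) auto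
          ultimately have "f z s + \<delta> s / 2 * (norm (z - x))\<^sup>2 + \<phi> z - f x s - \<phi> x
            \<le> f z s + \<delta> s / 2 * (n + \<rho>)\<^sup>2 + \<phi> z - f w s + M s * \<rho> + \<delta> s / 2 * \<rho>\<^sup>2 - \<phi> w + L * \<rho>"
            using fw by linarith
          then show ?thesis unfolding q_def N_def
            using sq a by (intro add_mono mult_left_mono) auto
        qed
        finally have "(norm (z - p))\<^sup>2 / (2 * l) \<le> q \<rho> s / (2 * l)"
          using l by (intro divide_right_mono) (auto simp: norm_minus_commute)
        then show "env l p \<le> U \<rho> s"
          using moreau_env_le[OF env_facts z(1), of p] by (simp add: U_def)
      qed
    qed
    have above: "(\<integral>s. U \<rho> s \<partial>P) \<le> H x + \<tau>" if x: "x \<in> ?K" "dist w x < \<rho>" for x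
    proof -
      have "\<bar>H x - H w\<bar> < \<tau> / 3"
        using \<rho>1(2)[of x] x \<rho> by (simp add: dist_commute[of w x] dist_real_def)
      then show ?thesis using \<psi>0 \<psi>\<rho> unfolding U_mean by linarith
    qed
    show "\<exists>\<rho>>0. \<exists>U. integrable P U \<and>
      (AE s in P. \<forall>x\<in>?K. dist w x < \<rho> \<longrightarrow> (\<forall>p. is_step a x s p \<longrightarrow> env l p \<le> U s)) \<and>
      (\<forall>x\<in>?K. dist w x < \<rho> \<longrightarrow>
        (\<integral>s. U s \<partial>P) \<le> env l x - a / l * (F x - env l x) + C * a\<^sup>2 + \<tau>)"
      using \<rho>(1) U_int below above unfolding H_def by blast
  qed (use l C M N_sq L in \<open>auto simp: N_def\<close>)
qed

section \<open>Cluster values\<close>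
text \<open>
  The values \<open>F (x k)\<close> change slowly, so every number between their lower and upper limits is
  approached along a subsequence, and by compactness it is the value at a cluster point \<open>z\<close> of the
  iterates. The gap vanishes in the limit, so \<open>z\<close> is a fixed point of the proximal map.
\<close>
lemma limit_values_are_stationary_values:
  assumes X: "\<And>k. x k \<in> X" and R: "\<And>k. norm (x k) \<le> R" and l: "l > 0"
    and gap: "(\<lambda>k. F (x k) - env l (x k)) \<longlonglongrightarrow> 0"
    and slow: "(\<lambda>k. norm (x (Suc k) - x k)) \<longlonglongrightarrow> 0"
  shows "{liminf (\<lambda>k. ereal (F (x k))) .. limsup (\<lambda>k. ereal (F (x k)))}
    \<subseteq> (\<lambda>z. ereal (F z)) ` stationary_set P X f \<phi>"
proof
  fix c' assume c': "c' \<in> {liminf (\<lambda>k. ereal (F (x k))) .. limsup (\<lambda>k. ereal (F (x k)))}"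
  let ?K = "X \<inter> cball 0 R"
  have K: "x k \<in> ?K" for k using X R by simp
  obtain b where b: "\<forall>y\<in>X. b \<le> F y" using objective_bounded_below by blast
  obtain B where B: "\<And>y. y \<in> ?K \<Longrightarrow> \<bar>F y\<bar> \<le> B"
    using bounded_on_iterate_region[OF continuous_objective, of R] by blast
  have "ereal (- B) \<le> liminf (\<lambda>k. ereal (F (x k)))"
    using B[OF K] by (intro Liminf_bounded) (auto simp: abs_le_iff minus_le_iff)
  moreover have "limsup (\<lambda>k. ereal (F (x k))) \<le> ereal B"
    using B[OF K] by (intro Limsup_bounded) (auto simp: abs_le_iff)
  ultimately have "ereal (- B) \<le> c'" "c' \<le> ereal B" using c' by (auto intro: order.trans)
  then obtain c where c: "c' = ereal c" by (cases c') auto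
  have contF: "continuous_on ?K F" by (rule continuous_on_subset[OF continuous_objective]) auto
  have "uniformly_continuous_on ?K F"
    by (rule compact_uniformly_continuous[OF contF compact_cball_X])
  then have "(\<lambda>k. dist (F (x (Suc k))) (F (x k))) \<longlonglongrightarrow> 0"
    unfolding uniformly_continuous_on_sequentially using K slow by (auto simp: dist_norm)
  then have "(\<lambda>k. F (x (Suc k)) - F (x k)) \<longlonglongrightarrow> 0"
    by (simp add: dist_real_def tendsto_rabs_zero_iff)
  then have "\<exists>k\<ge>n. \<bar>F (x k) - c\<bar> < 1 / real (Suc n)" for n
    using c' c by (intro slow_sequence_visits_between_liminf_limsup) auto
  then obtain \<kappa> where \<kappa>: "\<And>n. \<kappa> n \<ge> n" "\<And>n. \<bar>F (x (\<kappa> n)) - c\<bar> < 1 / real (Suc n)" by metis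
  have "(\<lambda>n. F (x (\<kappa> n)) - c) \<longlonglongrightarrow> 0"
    using \<kappa>(2) by (intro Lim_null_comparison[OF _ LIMSEQ_inverse_real_of_nat])
      (auto simp: inverse_eq_divide intro!: always_eventually less_imp_le)
  then have Fc: "(\<lambda>n. F (x (\<kappa> n))) \<longlonglongrightarrow> c" by (rule LIM_zero_cancel)
  have "\<forall>n. (x \<circ> \<kappa>) n \<in> ?K" using K by simp
  then obtain z r where z: "z \<in> ?K" and r: "strict_mono r" and lim: "((x \<circ> \<kappa>) \<circ> r) \<longlonglongrightarrow> z"
    using compact_cball_X[of R] unfolding compact_def by metis
  have lim': "(\<lambda>n. x (\<kappa> (r n))) \<longlonglongrightarrow> z" using lim by (simp add: comp_def)
  have Fz: "(\<lambda>n. F (x (\<kappa> (r n)))) \<longlonglongrightarrow> F z"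
    using K by (intro continuous_on_tendsto_compose[OF contF lim' z]) auto
  moreover have "(\<lambda>n. F (x (\<kappa> (r n)))) \<longlonglongrightarrow> c"
    using LIMSEQ_subseq_LIMSEQ[OF Fc r] by (simp add: comp_def)
  ultimately have "F z = c" by (rule LIMSEQ_unique)
  have "(\<lambda>n. env l (x (\<kappa> (r n)))) \<longlonglongrightarrow> env l z"
    using continuous_on_tendsto_compose[OF continuous_env[OF l] lim'] by simp
  with Fz have "(\<lambda>n. F (x (\<kappa> (r n))) - env l (x (\<kappa> (r n)))) \<longlonglongrightarrow> F z - env l z"
    by (rule tendsto_diff)
  moreover have "filterlim (\<lambda>n. \<kappa> (r n)) at_top at_top"
    using \<kappa>(1) seq_suble[OF r]
    by (intro filterlim_at_top_mono[OF filterlim_ident] always_eventually) (meson order.trans)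
  from filterlim_compose[OF gap this]
  have "(\<lambda>n. F (x (\<kappa> (r n))) - env l (x (\<kappa> (r n)))) \<longlonglongrightarrow> 0" .
  ultimately have "F z - env l z = 0" by (rule LIMSEQ_unique)
  moreover have "env l z \<le> F y + (norm (y - z))\<^sup>2 / (2 * l)" if "y \<in> X" for y
    by (rule moreau_env_le[OF X_nonempty b l that])
  ultimately have "z \<in> stationary_set P X f \<phi>"
    using z by (intro stationary_if_proximal_fixpoint[OF _ l]) auto
  then show "c' \<in> (\<lambda>z. ereal (F z)) ` stationary_set P X f \<phi>"
    using \<open>F z = c\<close> c by blast
qed

end

section \<open>The random iterates\<close>
locale model_based_process = stochastic_model P X f m \<phi> + \<Omega>: prob_space \<Omega>
  for P :: "'s measure"
    and X :: "'a::euclidean_space set"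
    and f :: "'a \<Rightarrow> 's \<Rightarrow> real"
    and m :: "'a \<Rightarrow> 'a \<Rightarrow> 's \<Rightarrow> ereal"
    and \<phi> :: "'a \<Rightarrow> real"
    and \<Omega> :: "'w measure" +
  fixes \<alpha> :: "nat \<Rightarrow> real" and S :: "nat \<Rightarrow> 'w \<Rightarrow> 's" and x0 :: 'a and x :: "nat \<Rightarrow> 'w \<Rightarrow> 'a"
  assumes \<alpha>_pos: "\<And>k. \<alpha> k > 0" and \<alpha>_diverges: "\<not> summable \<alpha>"
    and \<alpha>_square_summable: "summable (\<lambda>k. (\<alpha> k)\<^sup>2)"
    and x0: "x0 \<in> X"
    and iteration: "model_based_iteration \<Omega> P X m \<phi> \<alpha> S x0 x"
begin

abbreviation past :: "nat \<Rightarrow> 'w measure" where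
  "past k \<equiv> past_samples \<Omega> P S k"

lemma indep_samples: "\<Omega>.indep_vars (\<lambda>_. P) S UNIV"
  and distr_sample: "distr \<Omega> P (S k) = P"
  and x_0: "\<omega> \<in> space \<Omega> \<Longrightarrow> x 0 \<omega> = x0"
  and x_Suc: "\<omega> \<in> space \<Omega> \<Longrightarrow> is_step (\<alpha> k) (x k \<omega>) (S k \<omega>) (x (Suc k) \<omega>)"
  and x_past: "x k \<in> borel_measurable (past k)"
  using iteration unfolding model_based_iteration_def by blast+

lemma measurable_sample: "S k \<in> measurable \<Omega> P"
  using indep_samples unfolding \<Omega>.indep_vars_def2 by simp

lemma x_in_X: "\<omega> \<in> space \<Omega> \<Longrightarrow> x k \<omega> \<in> X"
  using x_0 x0 x_Suc[of \<omega> "k - 1"] by (cases k) (auto simp: is_arg_min_def)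

lemma past_measurable_imp: "u \<in> borel_measurable (past k) \<Longrightarrow> u \<in> borel_measurable \<Omega>"
  using \<Omega>.past_samples_events[OF indep_samples, of k] unfolding measurable_def by auto

lemma past_measurable_mono:
  "j \<le> k \<Longrightarrow> u \<in> borel_measurable (past j) \<Longrightarrow> u \<in> borel_measurable (past k)"
  using \<Omega>.past_samples_mono[OF indep_samples, of j k] unfolding measurable_def by auto

lemma AE_sample: "AE s in P. Q s \<Longrightarrow> AE \<omega> in \<Omega>. Q (S k \<omega>)"
  using AE_distrD[OF measurable_sample[of k], where P = Q] unfolding distr_sample by blast

text \<open>
  Fresh samples factor out of expectations; the descent estimate uses this for indicators of
  past events, the summability of displacements for the stopped gap.
\<close>
lemma integral_past_times_present:
  fixes V :: "'w \<Rightarrow> real"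
  assumes V: "V \<in> borel_measurable (past k)" "integrable \<Omega> V" and U: "integrable P U"
  shows "integrable \<Omega> (\<lambda>\<omega>. V \<omega> * U (S k \<omega>))"
    and "(\<integral>\<omega>. V \<omega> * U (S k \<omega>) \<partial>\<Omega>) = (\<integral>\<omega>. V \<omega> \<partial>\<Omega>) * (\<integral>s. U s \<partial>P)"
proof -
  have Um: "U \<in> borel_measurable P" using U by simp
  have ind: "\<Omega>.indep_var borel V borel (\<lambda>\<omega>. U (S k \<omega>))"
    by (rule \<Omega>.indep_var_past_present[OF indep_samples V(1) Um])
  have "integrable (distr \<Omega> P (S k)) U" using U by (simp add: distr_sample)
  then have int: "integrable \<Omega> (\<lambda>\<omega>. U (S k \<omega>))"
    by (rule integrable_distr[OF measurable_sample])
  have "(\<integral>s. U s \<partial>P) = (\<integral>s. U s \<partial>distr \<Omega> P (S k))" by (simp add: distr_sample)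
  also have "\<dots> = (\<integral>\<omega>. U (S k \<omega>) \<partial>\<Omega>)" by (rule integral_distr[OF measurable_sample Um])
  finally have eq: "(\<integral>s. U s \<partial>P) = (\<integral>\<omega>. U (S k \<omega>) \<partial>\<Omega>)" .
  show "integrable \<Omega> (\<lambda>\<omega>. V \<omega> * U (S k \<omega>))"
    by (rule \<Omega>.indep_var_integrable[OF ind V(2) int])
  show "(\<integral>\<omega>. V \<omega> * U (S k \<omega>) \<partial>\<Omega>) = (\<integral>\<omega>. V \<omega> \<partial>\<Omega>) * (\<integral>s. U s \<partial>P)"
    unfolding eq by (rule \<Omega>.indep_var_lebesgue_integral[OF ind V(2) int])
qed

text \<open>
  The iterates are bounded only by a random constant. Stopping when they leave a fixed ball gives
  deterministic constants, and unlike the event that the iterates never leave, this event is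
  determined by the past.
\<close>
definition stays :: "real \<Rightarrow> nat \<Rightarrow> 'w set" where
  "stays R k = {\<omega> \<in> space \<Omega>. \<forall>j\<le>k. norm (x j \<omega>) \<le> R}"

lemma stays_past: "stays R k \<in> sets (past k)"
proof -
  have "x j -` cball 0 R \<inter> space (past k) \<in> sets (past k)" if "j \<le> k" for j
    by (rule measurable_sets[OF past_measurable_mono[OF that x_past]]) simp
  then have "(\<Inter>j\<in>{..k}. x j -` cball 0 R \<inter> space (past k)) \<in> sets (past k)"
    by (intro sets.finite_INT) auto
  moreover have "stays R k = (\<Inter>j\<in>{..k}. x j -` cball 0 R \<inter> space (past k))"
    by (auto simp: stays_def)
  ultimately show ?thesis by (simp only:)
qed

lemma stays_Suc: "stays R (Suc k) \<subseteq> stays R k"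
  by (auto simp: stays_def)

lemma stays_region: "\<omega> \<in> stays R k \<Longrightarrow> x k \<omega> \<in> X \<inter> cball 0 R"
  using x_in_X by (auto simp: stays_def)

lemma stopped_past:
  assumes "continuous_on X h"
  shows "(\<lambda>\<omega>. indicator (stays R k) \<omega> * h (x k \<omega>) :: real) \<in> borel_measurable (past k)"
    and "integrable \<Omega> (\<lambda>\<omega>. indicator (stays R k) \<omega> * h (x k \<omega>))"
proof -
  have "x k \<in> measurable (past k) (restrict_space borel X)"
    using x_in_X by (intro measurable_restrict_space2 x_past) auto
  from measurable_compose[OF this borel_measurable_continuous_on_restrict[OF assms]]
  have h: "(\<lambda>\<omega>. h (x k \<omega>)) \<in> borel_measurable (past k)" .
  show past: "(\<lambda>\<omega>. indicator (stays R k) \<omega> * h (x k \<omega>)) \<in> borel_measurable (past k)"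
    using h stays_past[of R k] by (intro borel_measurable_times borel_measurable_indicator) 
  obtain B where B: "\<And>x. x \<in> X \<inter> cball 0 R \<Longrightarrow> \<bar>h x\<bar> \<le> B"
    using bounded_on_iterate_region[OF assms, of R] by blast
  show "integrable \<Omega> (\<lambda>\<omega>. indicator (stays R k) \<omega> * h (x k \<omega>))"
  proof (rule \<Omega>.integrable_const_bound[where B = "\<bar>B\<bar>"])
    show "AE \<omega> in \<Omega>. norm (indicator (stays R k) \<omega> * h (x k \<omega>)) \<le> \<bar>B\<bar>"
      using B[OF stays_region[of _ R k]] by (intro AE_I2) (fastforce simp: indicator_def)
  qed (rule past_measurable_imp[OF past])
qed

text \<open>
  Stopping can only lose mass: \<open>stays R\<close> shrinks and the envelope minus its lower bound \<open>b\<close> is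
  nonnegative. This is why the Lyapunov function is shifted by \<open>b\<close>.
\<close>
lemma expected_descent:
  assumes l: "l > 0" and C: "C \<ge> 0" and b: "\<forall>y\<in>X. b \<le> F y"
    and cell: "\<And>w \<tau>. w \<in> X \<inter> cball 0 R \<Longrightarrow> \<tau> > 0 \<Longrightarrow> \<exists>\<rho>>0. \<exists>U. integrable P U \<and>
      (AE s in P. \<forall>x\<in>X \<inter> cball 0 R. dist w x < \<rho> \<longrightarrow> (\<forall>p. is_step (\<alpha> k) x s p \<longrightarrow> env l p \<le> U s)) \<and>
      (\<forall>x\<in>X \<inter> cball 0 R. dist w x < \<rho> \<longrightarrow>
        (\<integral>s. U s \<partial>P) \<le> env l x - \<alpha> k / l * (F x - env l x) + C * (\<alpha> k)\<^sup>2 + \<tau>)"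
  shows "(\<integral>\<omega>. indicator (stays R (Suc k)) \<omega> * (env l (x (Suc k) \<omega>) - b) \<partial>\<Omega>)
    \<le> (\<integral>\<omega>. indicator (stays R k) \<omega> * (env l (x k \<omega>) - b) \<partial>\<Omega>)
      - \<alpha> k / l * (\<integral>\<omega>. indicator (stays R k) \<omega> * (F (x k \<omega>) - env l (x k \<omega>)) \<partial>\<Omega>) + C * (\<alpha> k)\<^sup>2"
proof -
  let ?K = "X \<inter> cball 0 R"
  have ge: "b \<le> env l z" for z by (rule moreau_env_ge[OF X_nonempty b l])
  have cont_env: "continuous_on X (env l)" using continuous_env[OF l] continuous_on_subset by blast
  have cont: "continuous_on X (\<lambda>z. env l z - b)" "continuous_on X (\<lambda>z. F z - env l z)"
    by (intro continuous_intros continuous_objective cont_env)+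
  define W where "W = (\<lambda>\<omega>. indicator (stays R (Suc k)) \<omega> * (env l (x (Suc k) \<omega>) - b))"
  define V where "V = (\<lambda>z. (env l z - b) - \<alpha> k / l * (F z - env l z) + C * (\<alpha> k)\<^sup>2)"
  have cont_V: "continuous_on X V" unfolding V_def by (intro continuous_intros cont)
  have stays_ev: "stays R k \<in> \<Omega>.events"
    using stays_past \<Omega>.past_samples_events[OF indep_samples] by blast
  have W: "indicator (stays R k) \<omega> * W \<omega> = W \<omega>" for \<omega>
    using stays_Suc[of R k] by (auto simp: W_def indicator_def)
  have "(\<integral>\<omega>. indicator (stays R k) \<omega> * W \<omega> \<partial>\<Omega>) \<le> (\<integral>\<omega>. indicator (stays R k) \<omega> * V (x k \<omega>) \<partial>\<Omega>)"
  proof (rule \<Omega>.expectation_le_by_freezing[where H = "past k" and T = "S k" and P = P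
        and K = ?K and A = "stays R k" and Y = "x k" and W = W and V = V])
    show "sets (past k) \<subseteq> \<Omega>.events" by (rule \<Omega>.past_samples_events[OF indep_samples])
    show "integrable \<Omega> (\<lambda>\<omega>. indicator B \<omega> * U (S k \<omega>)) \<and>
        (\<integral>\<omega>. indicator B \<omega> * U (S k \<omega>) \<partial>\<Omega>) = \<Omega>.prob B * (\<integral>s. U s \<partial>P)"
      if B: "B \<in> sets (past k)" and U: "integrable P U" for B and U :: "'s \<Rightarrow> real"
    proof -
      have ev: "B \<in> \<Omega>.events" using B \<Omega>.past_samples_events[OF indep_samples] by blast
      have "(indicator B :: 'w \<Rightarrow> real) \<in> borel_measurable (past k)" using B by simp
      moreover have "integrable \<Omega> (indicator B :: 'w \<Rightarrow> real)"
        using ev by (intro integrable_real_indicator) (auto simp: less_top[symmetric])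
      ultimately show ?thesis using integral_past_times_present[OF _ _ U] ev by auto
    qed
    show "integrable \<Omega> (\<lambda>\<omega>. indicator (stays R k) \<omega> * W \<omega>)"
      unfolding W unfolding W_def by (rule stopped_past(2)[OF cont(1)])
    show "integrable \<Omega> (\<lambda>\<omega>. indicator (stays R k) \<omega> * V (x k \<omega>))"
      by (rule stopped_past(2)[OF cont_V])
  next
    fix w \<tau> assume "w \<in> ?K" "(\<tau>::real) > 0"
    from cell[OF this] obtain \<rho> U where \<rho>: "\<rho> > 0" and U: "integrable P U"
      and below: "AE s in P. \<forall>x\<in>?K. dist w x < \<rho> \<longrightarrow> (\<forall>p. is_step (\<alpha> k) x s p \<longrightarrow> env l p \<le> U s)"
      and above: "\<forall>x\<in>?K. dist w x < \<rho> \<longrightarrow>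
        (\<integral>s. U s \<partial>P) \<le> env l x - \<alpha> k / l * (F x - env l x) + C * (\<alpha> k)\<^sup>2 + \<tau>"
      by blast
    have "AE \<omega> in \<Omega>. \<omega> \<in> stays R k \<longrightarrow> dist w (x k \<omega>) < \<rho> \<longrightarrow> W \<omega> \<le> U (S k \<omega>) - b"
      using AE_sample[OF below, of k] AE_space
    proof eventually_elim
      case (elim \<omega>)
      show ?case
      proof (intro impI)
        assume "\<omega> \<in> stays R k" "dist w (x k \<omega>) < \<rho>"
        then have "env l (x (Suc k) \<omega>) \<le> U (S k \<omega>)"
          using elim stays_region x_Suc by blast
        then show "W \<omega> \<le> U (S k \<omega>) - b"
          using ge[of "x (Suc k) \<omega>"] by (simp add: W_def indicator_def)
      qed
    qed
    moreover have "integrable P (\<lambda>s. U s - b)" using U by simp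
    moreover have "\<forall>x\<in>?K. dist w x < \<rho> \<longrightarrow> (\<integral>s. U s - b \<partial>P) \<le> V x + \<tau>"
      using above U by (auto simp: V_def P.prob_space)
    ultimately show "\<exists>\<rho>>0. \<exists>U. integrable P U \<and>
        (AE \<omega> in \<Omega>. \<omega> \<in> stays R k \<longrightarrow> dist w (x k \<omega>) < \<rho> \<longrightarrow> W \<omega> \<le> U (S k \<omega>)) \<and>
        (\<forall>x\<in>?K. dist w x < \<rho> \<longrightarrow> (\<integral>s. U s \<partial>P) \<le> V x + \<tau>)"
      using \<rho> by (intro exI[of _ \<rho>] exI[of _ "\<lambda>s. U s - b"] conjI)
  next
    show "x k \<omega> \<in> ?K" if "\<omega> \<in> stays R k" for \<omega> using that by (rule stays_region)
  qed (simp_all add: stays_past x_past compact_cball_X)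
  also have "(\<integral>\<omega>. indicator (stays R k) \<omega> * V (x k \<omega>) \<partial>\<Omega>)
      = (\<integral>\<omega>. indicator (stays R k) \<omega> * (env l (x k \<omega>) - b)
          - \<alpha> k / l * (indicator (stays R k) \<omega> * (F (x k \<omega>) - env l (x k \<omega>)))
          + C * (\<alpha> k)\<^sup>2 * indicator (stays R k) \<omega> \<partial>\<Omega>)"
    by (intro Bochner_Integration.integral_cong) (auto simp: V_def indicator_def)
  also have "\<dots> = (\<integral>\<omega>. indicator (stays R k) \<omega> * (env l (x k \<omega>) - b) \<partial>\<Omega>)
      - \<alpha> k / l * (\<integral>\<omega>. indicator (stays R k) \<omega> * (F (x k \<omega>) - env l (x k \<omega>)) \<partial>\<Omega>)
      + C * (\<alpha> k)\<^sup>2 * \<Omega>.prob (stays R k)"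
  proof -
    have ind: "integrable \<Omega> (indicator (stays R k) :: 'w \<Rightarrow> real)"
      using stays_ev by (intro integrable_real_indicator) (auto simp: less_top[symmetric])
    note ints = stopped_past(2)[OF cont(1), of R k]
      integrable_mult_right[OF stopped_past(2)[OF cont(2), of R k], of "\<alpha> k / l"]
      integrable_mult_right[OF ind, of "C * (\<alpha> k)\<^sup>2"]
    show ?thesis
      unfolding Bochner_Integration.integral_add[OF Bochner_Integration.integrable_diff[OF ints(1,2)] ints(3)]
        Bochner_Integration.integral_diff[OF ints(1,2)]
      using stays_ev by simp
  qed
  also have "C * (\<alpha> k)\<^sup>2 * \<Omega>.prob (stays R k) \<le> C * (\<alpha> k)\<^sup>2 * 1"
    using C by (intro mult_left_mono) auto
  finally show ?thesis unfolding W by (simp add: W_def)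
qed

text \<open>
  Telescoping the expected descent shows that \<open>\<Sum>k. \<alpha> k * E (g k)\<close> converges, where \<open>g k\<close> is the stopped
  gap. The displacement is at most \<open>\<alpha> k * N (S k)\<close>, and \<open>N (S k)\<close> is independent of \<open>g k\<close>, so the sum of
  displacement times gap has a finite mean as well. These two series control the
  gap along a path.
\<close>
lemma proximal_gap_tends_to_zero:
  obtains l where "l > 0"
    and "AE \<omega> in \<Omega>. (\<forall>k. norm (x k \<omega>) \<le> R) \<longrightarrow>
      (\<lambda>k. F (x k \<omega>) - env l (x k \<omega>)) \<longlonglongrightarrow> 0 \<and> (\<lambda>k. norm (x (Suc k) \<omega> - x k \<omega>)) \<longlonglongrightarrow> 0"
proof -
  let ?K = "X \<inter> cball 0 R"
  obtain l C N where l: "l > 0" and C: "C \<ge> 0"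
    and N: "N \<in> borel_measurable P" "\<And>s. 0 \<le> N s" "integrable P (\<lambda>s. (N s)\<^sup>2)"
    and step: "AE s in P. \<forall>x\<in>?K. \<forall>a>0. \<forall>p. is_step a x s p \<longrightarrow> norm (p - x) \<le> a * N s"
    and cell: "\<And>w \<tau> a. w \<in> ?K \<Longrightarrow> \<tau> > 0 \<Longrightarrow> a > 0 \<Longrightarrow> \<exists>\<rho>>0. \<exists>U. integrable P U \<and>
      (AE s in P. \<forall>x\<in>?K. dist w x < \<rho> \<longrightarrow> (\<forall>p. is_step a x s p \<longrightarrow> env l p \<le> U s)) \<and>
      (\<forall>x\<in>?K. dist w x < \<rho> \<longrightarrow>
        (\<integral>s. U s \<partial>P) \<le> env l x - a / l * (F x - env l x) + C * a\<^sup>2 + \<tau>)"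
    using one_step_descent[of R] by blast
  obtain b where b: "\<forall>y\<in>X. b \<le> F y" using objective_bounded_below by blast
  have N_int: "integrable P N" using P.square_integrable_imp_integrable[OF N(1,3)] .
  have cont_env: "continuous_on X (env l)" using continuous_env[OF l] continuous_on_subset by blast
  define G where "G = (\<lambda>z. F z - env l z)"
  have cont_G: "continuous_on X G"
    unfolding G_def by (intro continuous_intros continuous_objective cont_env)
  have cont_e: "continuous_on X (\<lambda>z. env l z - b)" by (intro continuous_intros cont_env)
  have G_nonneg: "G z \<ge> 0" if "z \<in> X" for z
    using moreau_env_le_self[OF X_nonempty b l that] by (simp add: G_def)
  define g where "g = (\<lambda>k \<omega>. indicator (stays R k) \<omega> * G (x k \<omega>))"
  have g_nonneg: "0 \<le> g k \<omega>" if "\<omega> \<in> space \<Omega>" for k \<omega>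
    using G_nonneg[OF x_in_X[OF that]] by (simp add: g_def)
  have g_past: "g k \<in> borel_measurable (past k)" and g_int: "integrable \<Omega> (g k)" for k
    unfolding g_def by (rule stopped_past[OF cont_G])+
  have Eg: "0 \<le> (\<integral>\<omega>. g k \<omega> \<partial>\<Omega>)" for k
    using g_nonneg by (intro Bochner_Integration.integral_nonneg)
  define e where "e = (\<lambda>k. \<integral>\<omega>. indicator (stays R k) \<omega> * (env l (x k \<omega>) - b) \<partial>\<Omega>)"
  have e_nonneg: "0 \<le> e k" for k
    unfolding e_def using moreau_env_ge[OF X_nonempty b l]
    by (intro Bochner_Integration.integral_nonneg) (simp add: indicator_def)
  have descent: "\<alpha> k * (\<integral>\<omega>. g k \<omega> \<partial>\<Omega>) \<le> l * (e k - e (Suc k)) + l * C * (\<alpha> k)\<^sup>2" for k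
  proof -
    have "e (Suc k) \<le> e k - \<alpha> k / l * (\<integral>\<omega>. g k \<omega> \<partial>\<Omega>) + C * (\<alpha> k)\<^sup>2"
      unfolding e_def g_def G_def
      by (rule expected_descent[OF l C b cell[OF _ _ \<alpha>_pos]])
    then show ?thesis using l by (simp add: field_simps)
  qed
  have sum_bound: "(\<Sum>k<n. \<alpha> k * (\<integral>\<omega>. g k \<omega> \<partial>\<Omega>)) \<le> l * e 0 + l * C * (\<Sum>k. (\<alpha> k)\<^sup>2)" for n
  proof -
    have "(\<Sum>k<n. \<alpha> k * (\<integral>\<omega>. g k \<omega> \<partial>\<Omega>)) \<le> (\<Sum>k<n. l * (e k - e (Suc k)) + l * C * (\<alpha> k)\<^sup>2)"
      by (intro sum_mono descent)
    also have "\<dots> = l * (e 0 - e n) + l * C * (\<Sum>k<n. (\<alpha> k)\<^sup>2)"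
      by (simp add: sum.distrib sum_lessThan_telescope' flip: sum_distrib_left)
    also have "\<dots> \<le> l * e 0 + l * C * (\<Sum>k. (\<alpha> k)\<^sup>2)"
      using l C e_nonneg[of n] \<alpha>_square_summable
      by (intro add_mono mult_left_mono sum_le_suminf) auto
    finally show ?thesis .
  qed
  have summ: "summable (\<lambda>k. \<alpha> k * (\<integral>\<omega>. g k \<omega> \<partial>\<Omega>))"
    using sum_bound Eg \<alpha>_pos by (intro summableI_nonneg_bounded) (auto simp: less_imp_le)
  have AE1: "AE \<omega> in \<Omega>. summable (\<lambda>k. \<alpha> k * g k \<omega>)"
    using g_int g_nonneg \<alpha>_pos summ
    by (intro AE_summable_if_summable_integrals) (auto simp: less_imp_le)
  have AE2: "AE \<omega> in \<Omega>. summable (\<lambda>k. \<alpha> k * (g k \<omega> * N (S k \<omega>)))"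
  proof (rule AE_summable_if_summable_integrals)
    show "integrable \<Omega> (\<lambda>\<omega>. \<alpha> k * (g k \<omega> * N (S k \<omega>)))" for k
      using integral_past_times_present(1)[OF g_past g_int N_int] by simp
    show "0 \<le> \<alpha> k * (g k \<omega> * N (S k \<omega>))" if "\<omega> \<in> space \<Omega>" for k \<omega>
      using g_nonneg[OF that] N(2) \<alpha>_pos[of k] by simp
    have "summable (\<lambda>k. (\<alpha> k * (\<integral>\<omega>. g k \<omega> \<partial>\<Omega>)) * (\<integral>s. N s \<partial>P))"
      using summ by (rule summable_mult2)
    then show "summable (\<lambda>k. \<integral>\<omega>. \<alpha> k * (g k \<omega> * N (S k \<omega>)) \<partial>\<Omega>)"
      using integral_past_times_present(2)[OF g_past g_int N_int] by (simp add: mult.assoc)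
  qed
  have AE3: "AE \<omega> in \<Omega>. summable (\<lambda>k. (\<alpha> k)\<^sup>2 * (N (S k \<omega>))\<^sup>2)"
  proof (rule AE_summable_if_summable_integrals)
    have one: "(\<lambda>_. 1 :: real) \<in> borel_measurable (past k)" "integrable \<Omega> (\<lambda>_. 1 :: real)" for k by auto
    have N2: "integrable \<Omega> (\<lambda>\<omega>. (N (S k \<omega>))\<^sup>2)"
      "(\<integral>\<omega>. (N (S k \<omega>))\<^sup>2 \<partial>\<Omega>) = (\<integral>s. (N s)\<^sup>2 \<partial>P)" for k
      using integral_past_times_present[OF one N(3), of k] by (simp_all add: \<Omega>.prob_space)
    show "integrable \<Omega> (\<lambda>\<omega>. (\<alpha> k)\<^sup>2 * (N (S k \<omega>))\<^sup>2)" for k using N2(1) by simp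
    show "summable (\<lambda>k. \<integral>\<omega>. (\<alpha> k)\<^sup>2 * (N (S k \<omega>))\<^sup>2 \<partial>\<Omega>)"
      using summable_mult2[OF \<alpha>_square_summable] by (simp add: N2(2))
  qed simp
  have AE4: "AE \<omega> in \<Omega>. \<forall>k. norm (x k \<omega>) \<le> R \<longrightarrow> norm (x (Suc k) \<omega> - x k \<omega>) \<le> \<alpha> k * N (S k \<omega>)"
  proof (unfold AE_all_countable, rule allI)
    fix k
    show "AE \<omega> in \<Omega>. norm (x k \<omega>) \<le> R \<longrightarrow> norm (x (Suc k) \<omega> - x k \<omega>) \<le> \<alpha> k * N (S k \<omega>)"
      using AE_sample[OF step, of k] AE_space
      by eventually_elim (use x_in_X x_Suc \<alpha>_pos in auto)
  qed
  have "AE \<omega> in \<Omega>. (\<forall>k. norm (x k \<omega>) \<le> R) \<longrightarrow>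
      (\<lambda>k. G (x k \<omega>)) \<longlonglongrightarrow> 0 \<and> (\<lambda>k. norm (x (Suc k) \<omega> - x k \<omega>)) \<longlonglongrightarrow> 0"
    using AE1 AE2 AE3 AE4 AE_space
  proof eventually_elim
    case (elim \<omega>)
    show ?case
    proof
      assume bd: "\<forall>k. norm (x k \<omega>) \<le> R"
      then have "\<omega> \<in> stays R k" for k using elim(5) by (simp add: stays_def)
      then have g: "g k \<omega> = G (x k \<omega>)" for k by (simp add: g_def)
      have K: "x k \<omega> \<in> ?K" for k using bd x_in_X elim(5) by simp
      have nn: "0 \<le> G (x k \<omega>)" for k using G_nonneg K by simp
      have move: "norm (x (Suc k) \<omega> - x k \<omega>) \<le> \<alpha> k * N (S k \<omega>)" for k using elim(4) bd by simp
      have "(\<lambda>k. (\<alpha> k * N (S k \<omega>))\<^sup>2) \<longlonglongrightarrow> 0"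
        using summable_LIMSEQ_zero[OF elim(3)] by (simp add: power_mult_distrib)
      from tendsto_real_sqrt[OF this] have "(\<lambda>k. \<bar>\<alpha> k * N (S k \<omega>)\<bar>) \<longlonglongrightarrow> 0" by simp
      moreover have "\<forall>\<^sub>F k in sequentially. norm (norm (x (Suc k) \<omega> - x k \<omega>)) \<le> \<bar>\<alpha> k * N (S k \<omega>)\<bar>"
        using order.trans[OF move abs_ge_self] by (simp add: always_eventually)
      ultimately have slow: "(\<lambda>k. norm (x (Suc k) \<omega> - x k \<omega>)) \<longlonglongrightarrow> 0"
        by (rule Lim_null_comparison[rotated])
      have "(\<lambda>k. G (x k \<omega>)) \<longlonglongrightarrow> 0"
      proof (rule tendsto_zero_along_path[where K = ?K and a = \<alpha> and G = G and x = "\<lambda>k. x k \<omega>"])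
        show "uniformly_continuous_on ?K G"
          by (intro compact_uniformly_continuous compact_cball_X continuous_on_subset[OF cont_G]) auto
        show "summable (\<lambda>k. \<alpha> k * G (x k \<omega>))" using elim(1) by (simp add: g)
        show "summable (\<lambda>k. dist (x (Suc k) \<omega>) (x k \<omega>) * G (x k \<omega>))"
        proof (rule summable_comparison_test'[OF elim(2)])
          fix k
          have "dist (x (Suc k) \<omega>) (x k \<omega>) * G (x k \<omega>) \<le> \<alpha> k * N (S k \<omega>) * G (x k \<omega>)"
            using move nn by (intro mult_right_mono) (auto simp: dist_norm)
          then show "norm (dist (x (Suc k) \<omega>) (x k \<omega>) * G (x k \<omega>)) \<le> \<alpha> k * (g k \<omega> * N (S k \<omega>))"
            using nn by (simp add: g mult.assoc mult.left_commute mult.commute)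
        qed
      qed (use K nn \<alpha>_pos \<alpha>_diverges in \<open>auto simp: less_imp_le\<close>)
      with slow show "(\<lambda>k. G (x k \<omega>)) \<longlonglongrightarrow> 0 \<and> (\<lambda>k. norm (x (Suc k) \<omega> - x k \<omega>)) \<longlonglongrightarrow> 0" by simp
    qed
  qed
  then show thesis unfolding G_def by (rule that[OF l])
qed

text \<open>
  The parameter \<open>l\<close> depends on the radius of the ball, but countably many radii suffice, and the
  notion of stationarity does not refer to \<open>l\<close>.
\<close>
lemma limit_values_stationary:
  assumes bounded: "AE \<omega> in \<Omega>. bounded (range (\<lambda>k. x k \<omega>))"
  shows "AE \<omega> in \<Omega>. {liminf (\<lambda>k. ereal (F (x k \<omega>))) .. limsup (\<lambda>k. ereal (F (x k \<omega>)))}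
    \<subseteq> (\<lambda>z. ereal (F z)) ` stationary_set P X f \<phi>"
proof -
  have "\<forall>n. \<exists>l>0. AE \<omega> in \<Omega>. (\<forall>k. norm (x k \<omega>) \<le> real n) \<longrightarrow>
      (\<lambda>k. F (x k \<omega>) - env l (x k \<omega>)) \<longlonglongrightarrow> 0 \<and> (\<lambda>k. norm (x (Suc k) \<omega> - x k \<omega>)) \<longlonglongrightarrow> 0"
  proof
    fix n :: nat
    show "\<exists>l>0. AE \<omega> in \<Omega>. (\<forall>k. norm (x k \<omega>) \<le> real n) \<longrightarrow>
        (\<lambda>k. F (x k \<omega>) - env l (x k \<omega>)) \<longlonglongrightarrow> 0 \<and> (\<lambda>k. norm (x (Suc k) \<omega> - x k \<omega>)) \<longlonglongrightarrow> 0"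
      by (rule proximal_gap_tends_to_zero[of "real n"]) (intro exI conjI)
  qed
  from choice[OF this] obtain l where l: "\<And>n. l n > 0"
    and "\<And>n. AE \<omega> in \<Omega>. (\<forall>k. norm (x k \<omega>) \<le> real n) \<longrightarrow>
      (\<lambda>k. F (x k \<omega>) - env (l n) (x k \<omega>)) \<longlonglongrightarrow> 0 \<and> (\<lambda>k. norm (x (Suc k) \<omega> - x k \<omega>)) \<longlonglongrightarrow> 0"
    by blast
  then have "AE \<omega> in \<Omega>. \<forall>n. (\<forall>k. norm (x k \<omega>) \<le> real n) \<longrightarrow>
      (\<lambda>k. F (x k \<omega>) - env (l n) (x k \<omega>)) \<longlonglongrightarrow> 0 \<and> (\<lambda>k. norm (x (Suc k) \<omega> - x k \<omega>)) \<longlonglongrightarrow> 0"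
    unfolding AE_all_countable by blast
  with bounded AE_space show ?thesis
  proof eventually_elim
    case (elim \<omega>)
    obtain B where B: "\<And>k. norm (x k \<omega>) \<le> B" using elim(1) unfolding bounded_iff by auto
    obtain n where "B \<le> real n" using real_arch_simple by blast
    then have n: "\<And>k. norm (x k \<omega>) \<le> real n" using B order.trans by blast
    show ?case
      using elim(3) n by (intro limit_values_are_stationary_values[OF x_in_X[OF elim(2)] n l]) auto
  qed
qed

end

section \<open>Limit values of the model-based iteration\<close>
theorem theorem3p20:
  fixes P :: "'s measure"
    and \<Omega> :: "'w measure"
    and X :: "'a::euclidean_space set"
    and f :: "'a \<Rightarrow> 's \<Rightarrow> real"
    and m :: "'a \<Rightarrow> 'a \<Rightarrow> 's \<Rightarrow> ereal"
    and \<phi> :: "'a \<Rightarrow> real"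
    and \<alpha> :: "nat \<Rightarrow> real"
    and S :: "nat \<Rightarrow> 'w \<Rightarrow> 's"
    and x0 :: 'a
    and x :: "nat \<Rightarrow> 'w \<Rightarrow> 'a"
  assumes "prob_space P" and "prob_space \<Omega>"
    and "X \<noteq> {}" and "closed X" and "convex X"
    and "convex_on UNIV \<phi>" and "closed (epigraph UNIV \<phi>)"
    and "\<And>z. integrable P (f z)"
    and "\<And>z y s. z \<in> X \<Longrightarrow> s \<in> space P \<Longrightarrow> m z y s \<noteq> -\<infinity>"
    and "\<And>z y. z \<in> X \<Longrightarrow> m z y \<in> borel_measurable P"
    and "local_lipschitz_cond P X f"
    and "weak_convexity_cond P X f"
    and "model_convex P X m"
    and "model_value P X f m"
    and "model_subdiff P X f m"
    and "model_accuracy P X f m"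
    and "\<And>k. \<alpha> k > 0" and "\<not> summable \<alpha>" and "summable (\<lambda>k. (\<alpha> k)\<^sup>2)"
    and "x0 \<in> X"
    and "model_based_iteration \<Omega> P X m \<phi> \<alpha> S x0 x"
    and "AE \<omega> in \<Omega>. bounded (range (\<lambda>k. x k \<omega>))"
    and "((\<lambda>z. if z \<in> X then ereal (objective P f \<phi> z) else \<infinity>) \<longlongrightarrow> \<infinity>) at_infinity"
  shows "AE \<omega> in \<Omega>.
           {liminf (\<lambda>k. ereal (objective P f \<phi> (x k \<omega>))) ..
            limsup (\<lambda>k. ereal (objective P f \<phi> (x k \<omega>)))}
           \<subseteq> (\<lambda>z. ereal (objective P f \<phi> z)) ` stationary_set P X f \<phi>"
proof -
  interpret P: prob_space P by fact
  interpret \<Omega>: prob_space \<Omega> by fact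
  interpret model_based_process P X f m \<phi> \<Omega> \<alpha> S x0 x
    by unfold_locales (fact assms)+
  show ?thesis using assms(22) by (rule limit_values_stationary)
qed

end
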